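(* Let $M$ be an $n$-dimensional Frobenius manifold with monodromy data $(\mu,R)$ at $z=0$, calibrated by a calibration $(\theta_{\alpha,m})$ associated to $(\mu,R)$, and let $\kappa\in\{1,\dots,n\}$ be such that multiplication by $\frac{\partial}{\partial v^\kappa}$ is invertible on the flat chart $B$ ($\phi(B)$ a sufficiently small ball). Then $(\mu,R)$ can also be taken as monodromy data at $z=0$ for the Frobenius manifold $S_\kappa(M)$ (with respect to the flat coordinates $\hat v^1,\dots,\hat v^n$). Moreover, the holomorphic functions $$\hat\theta_{\alpha,m}(\hat{\mathbf v}):=\Omega^{M,[0]}_{\alpha,m;\kappa,0}(\mathbf v(\hat{\mathbf v})),\qquad \alpha=1,\dots,n,\ m\ge 0,$$ form a calibration on $S_\kappa(M)$ associated to $(\mu,R)$.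
   Context: **Frobenius manifold.** A Frobenius manifold of charge $D$ is a complex manifold $M$ with a family of Frobenius algebra structures on the tangent spaces $T_pM$, holomorphic in $p$ (commutative associative product $\cdot$ with unity $e$, symmetric nondegenerate bilinear form with $\langle x\cdot y,z\rangle=\langle x,y\cdot z\rangle$), such that: (A1) $\langle\,,\rangle$ is flat with Levi-Civita connection $\nabla$, and $\nabla e=0$; (A2) with $c(X,Y,Z)=\langle X\cdot Y,Z\rangle$, the 4-tensor $\nabla c$ is symmetric; (A3) there is a holomorphic vector field $E$ (Euler vector field) with $[E,X\cdot Y]-[E,X]\cdot Y-X\cdot[E,Y]=X\cdot Y$ and $E\langle X,Y\rangle-\langle[E,X],Y\rangle-\langle X,[E,Y]\rangle=(2-D)\langle X,Y\rangle$. **Coordinates.** $(B,\phi)$ is a flat chart with $\phi(B)$ a small ball, flat coordinates $\mathbf v=(v^1,\dots,v^n)$, $\frac{\partial}{\partial v^\iota}=e$, $\eta_{\alpha\beta}=\langle\frac{\partial}{\partial v^\alpha},\frac{\partial}{\partial v^\beta}\rangle$ (constant), $\eta=(\eta_{\alpha\beta})$, $(\eta^{\alpha\beta})=\eta^{-1}$, $v_\alpha=\sum_\rho\eta_{\alpha\rho}v^\rho$, $\frac{\partial}{\partial v^\alpha}\cdot\frac{\partial}{\partial v^\beta}=\sum_\gamma c^\gamma_{\alpha\beta}\frac{\partial}{\partial v^\gamma}$. It is assumed that the flat coordinates can be chosen with $E=\sum_\beta E^\beta\frac{\partial}{\partial v^\beta}$, $E^\beta=(1-\frac D2-\mu_\beta)v^\beta+r^\beta$,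 with constants $\mu_\beta,r^\beta$, $\mu_\iota=-\frac D2$, $r^\iota=0$. Put $\mu=\mathrm{diag}(\mu_1,\dots,\mu_n)$. **Monodromy data at $z=0$.** Let $c_\alpha=(c^\gamma_{\alpha\beta})$ be the matrix of multiplication by $\frac{\partial}{\partial v^\alpha}$ and $\mathcal U^\alpha_\beta=\sum_\rho E^\rho c^\alpha_{\rho\beta}$. $(\mu,R)$, with $R$ a constant matrix, are monodromy data at $z=0$ if $R=\sum_{s\ge1}R_s$ (finite sum), $z^\mu Rz^{-\mu}=\sum_{s\ge1}R_sz^s$, $\eta^{-1}R_s^T\eta=(-1)^{s+1}R_s$, and the system $\frac{\partial y}{\partial v^\alpha}=zc_\alpha y$ ($\alpha=1,\dots,n$), $\frac{dy}{dz}=(\mathcal U+\frac\mu z)y$ has a fundamental matrix solution $\Theta(\mathbf v;z)z^\mu z^R$ with $\Theta$ analytic on $B\times\mathbb C$, $\Theta(\mathbf v;0)=I$, $\eta^{-1}\Theta(\mathbf v;-z)^T\eta\,\Theta(\mathbf v;z)=I$. **Calibration.** A calibration associated to $(\mu,R)$ is a family of holomorphic functions $\theta_{\alpha,m}(\mathbf v)$, $m\ge0$, such that with $\theta_\alpha(\mathbf v;z)=\sum_{m\ge0}\theta_{\alpha,m}z^m$: $\theta_{\alpha,0}=v_\alpha$; $\frac{\partial^2\theta_{\gamma,m+1}}{\partial v^\alpha\partial v^\beta}=\sum_\sigma c^\sigma_{\alpha\beta}\frac{\partial\theta_{\gamma,m}}{\partial v^\sigma}$; $\langle\nabla\theta_\alpha(\mathbf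 v;z),\nabla\theta_\beta(\mathbf v;-z)\rangle=\eta_{\alpha\beta}$ ($\nabla$ of a function is its gradient); $\frac{\partial\theta_{\alpha,m+1}}{\partial v^\iota}=\theta_{\alpha,m}$; and $$E\Big(\frac{\partial\theta_{\alpha,m}}{\partial v^\beta}\Big)=(m+\mu_\alpha+\mu_\beta)\frac{\partial\theta_{\alpha,m}}{\partial v^\beta}+\sum_\gamma\sum_{k=1}^m(R_k)^\gamma_\alpha\frac{\partial\theta_{\gamma,m-k}}{\partial v^\beta}.$$ The fundamental solution used is the one with $\Theta^\alpha_\beta=\sum_\gamma\eta^{\alpha\gamma}\frac{\partial\theta_\beta(\mathbf v;z)}{\partial v^\gamma}$. The genus zero two-point functions are defined by $\sum_{m_1,m_2\ge0}\Omega^{M,[0]}_{\alpha,m_1;\beta,m_2}(\mathbf v)z^{m_1}w^{m_2}=\frac{\langle\nabla\theta_\alpha(\mathbf v;z),\nabla\theta_\beta(\mathbf v;w)\rangle-\eta_{\alpha\beta}}{z+w}$. **Legendre-type transformation $S_\kappa(M)$.** When $\frac{\partial}{\partial v^\kappa}\cdot$ is invertible on $B$, $S_\kappa(M)=(B,\cdot,e,\langle\,,\rangle^\wedge,E)$ with the same product, unity and Euler field and $\langle x,y\rangle^\wedge=\langle\frac{\partial}{\partial v^\kappa}\cdot x,\frac{\partial}{\partial v^\kappa}\cdot y\rangle$. It is a Frobenius manifold of charge $\hat D=-2\mu_\kappa$ (Dubrovin). Its flat coordinates are $\hat v^\alpha=\sum_\beta\eta^{\alpha\beta}\hat v_\beta$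 with $\hat v_\alpha=\Omega^{M,[0]}_{\alpha,0;\kappa,0}(\mathbf v)$, $\hat{\mathbf v}=(\hat v^1,\dots,\hat v^n)$; in them $\langle\frac{\partial}{\partial\hat v^\alpha},\frac{\partial}{\partial\hat v^\beta}\rangle^\wedge=\eta_{\alpha\beta}$, $e=\frac{\partial}{\partial\hat v^\kappa}$, and $\hat E^\beta=(1-\frac{\hat D}2-\mu_\beta)\hat v^\beta+(R_1)^\beta_\kappa$. The notions of monodromy data and calibration for $S_\kappa(M)$ are those above with $\mathbf v,\langle\,,\rangle,D,\iota$ replaced by $\hat{\mathbf v},\langle\,,\rangle^\wedge,\hat D,\kappa$ (and $\eta$, $\mu$ the same matrices). *)

theory Defs
  imports "HOL-Analysis.Analysis"
begin

text \<open>
  A chart is a domain together with its coordinate map. Tensor fields are given by their components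
  in the charts of the maximal atlas, subject to the usual transformation laws.
\<close>

type_synonym ('m, 'n) chart = "'m set \<times> ('m \<Rightarrow> complex^'n)"

abbreviation dom_of :: "('m, 'n) chart \<Rightarrow> 'm set" where
  "dom_of c \<equiv> fst c"

abbreviation coord :: "('m, 'n) chart \<Rightarrow> 'm \<Rightarrow> complex^'n" where
  "coord c \<equiv> snd c"

definition point_at :: "('m, 'n) chart \<Rightarrow> complex^'n \<Rightarrow> 'm" where
  "point_at c = inv_into (dom_of c) (coord c)"

definition hol_on :: "(complex^'n::finite \<Rightarrow> complex) \<Rightarrow> (complex^'n) set \<Rightarrow> bool" where
  "hol_on f S \<longleftrightarrow>
     (\<forall>x\<in>S. \<exists>a::complex^'n. (f has_derivative (\<lambda>h. \<Sum>i\<in>UNIV. a $ i * h $ i)) (at x))"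

definition is_chart :: "('m::topological_space, 'n::finite) chart \<Rightarrow> bool" where
  "is_chart c \<longleftrightarrow> open (dom_of c) \<and> open (coord c ` dom_of c) \<and>
     homeomorphism (dom_of c) (coord c ` dom_of c) (coord c) (point_at c)"

definition compatible :: "('m, 'n::finite) chart \<Rightarrow> ('m, 'n) chart \<Rightarrow> bool" where
  "compatible c d \<longleftrightarrow>
     (\<forall>i. hol_on (\<lambda>x. coord d (point_at c x) $ i) (coord c ` (dom_of c \<inter> dom_of d))) \<and>
     (\<forall>i. hol_on (\<lambda>x. coord c (point_at d x) $ i) (coord d ` (dom_of c \<inter> dom_of d)))"

definition complex_manifold ::
  "'m::{t2_space, second_countable_topology} set \<Rightarrow> ('m, 'n::finite) chart set \<Rightarrow> bool" where
  "complex_manifold M A \<longleftrightarrow> open M \<and>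
     (\<forall>c\<in>A. is_chart c \<and> dom_of c \<subseteq> M) \<and>
     (\<Union>c\<in>A. dom_of c) = M \<and>
     (\<forall>c\<in>A. \<forall>d\<in>A. compatible c d) \<and>
     (\<forall>c. is_chart c \<and> dom_of c \<subseteq> M \<and> (\<forall>d\<in>A. compatible c d) \<longrightarrow> c \<in> A)"

definition holo :: "('m, 'n::finite) chart \<Rightarrow> ('m \<Rightarrow> complex) \<Rightarrow> bool" where
  "holo c f \<longleftrightarrow> hol_on (\<lambda>x. f (point_at c x)) (coord c ` dom_of c)"

definition pd :: "('m, 'n::finite) chart \<Rightarrow> 'n \<Rightarrow> ('m \<Rightarrow> complex) \<Rightarrow> 'm \<Rightarrow> complex" where
  "pd c i f p = deriv (\<lambda>t. f (point_at c (coord c p + t *s axis i 1))) 0"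

text \<open>\<open>jac c d p $ a $ i\<close> is the derivative of the \<open>a\<close>-th coordinate of \<open>d\<close> along the \<open>i\<close>-th one of \<open>c\<close>.\<close>

definition jac :: "('m, 'n::finite) chart \<Rightarrow> ('m, 'n) chart \<Rightarrow> 'm \<Rightarrow> complex^'n^'n" where
  "jac c d p = (\<chi> a i. pd c i (\<lambda>q. coord d q $ a) p)"

definition lie ::
  "('m, 'n::finite) chart \<Rightarrow> ('m \<Rightarrow> complex^'n) \<Rightarrow> ('m \<Rightarrow> complex^'n) \<Rightarrow> 'm \<Rightarrow> complex^'n" where
  "lie c X Y p = (\<chi> k. \<Sum>l\<in>UNIV. X p $ l * pd c l (\<lambda>q. Y q $ k) p - Y p $ l * pd c l (\<lambda>q. X q $ k) p)"

text \<open>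
  In the chart \<open>c\<close> at the point \<open>p\<close>, \<open>mul F c p k i j\<close> is the \<open>k\<close>-th component of the product of the
  \<open>i\<close>-th and \<open>j\<close>-th coordinate vector fields.
\<close>

record ('m, 'n) frobenius =
  points :: "'m set"
  charts :: "('m, 'n) chart set"
  mul :: "('m, 'n) chart \<Rightarrow> 'm \<Rightarrow> 'n \<Rightarrow> 'n \<Rightarrow> 'n \<Rightarrow> complex"
  unity :: "('m, 'n) chart \<Rightarrow> 'm \<Rightarrow> complex^'n"
  met :: "('m, 'n) chart \<Rightarrow> 'm \<Rightarrow> complex^'n^'n"
  euler :: "('m, 'n) chart \<Rightarrow> 'm \<Rightarrow> complex^'n"

definition vmul ::
  "('m, 'n::finite) frobenius \<Rightarrow> ('m, 'n) chart \<Rightarrow> 'm \<Rightarrow> complex^'n \<Rightarrow> complex^'n \<Rightarrow> complex^'n" where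
  "vmul F c p x y = (\<chi> k. \<Sum>i\<in>UNIV. \<Sum>j\<in>UNIV. mul F c p k i j * x $ i * y $ j)"

definition ip ::
  "('m, 'n::finite) frobenius \<Rightarrow> ('m, 'n) chart \<Rightarrow> 'm \<Rightarrow> complex^'n \<Rightarrow> complex^'n \<Rightarrow> complex" where
  "ip F c p x y = (\<Sum>i\<in>UNIV. \<Sum>j\<in>UNIV. met F c p $ i $ j * x $ i * y $ j)"

definition tensorial :: "('m, 'n::finite) frobenius \<Rightarrow> bool" where
  "tensorial F \<longleftrightarrow> (\<forall>c\<in>charts F. \<forall>d\<in>charts F. \<forall>p\<in>dom_of c \<inter> dom_of d.
     unity F d p = jac c d p *v unity F c p \<and>
     euler F d p = jac c d p *v euler F c p \<and>
     (\<forall>x y. vmul F d p (jac c d p *v x) (jac c d p *v y) = jac c d p *v vmul F c p x y) \<and>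
     (\<forall>x y. ip F d p (jac c d p *v x) (jac c d p *v y) = ip F c p x y))"

definition holomorphic_components :: "('m, 'n::finite) frobenius \<Rightarrow> bool" where
  "holomorphic_components F \<longleftrightarrow> (\<forall>c\<in>charts F. \<forall>i j k.
     holo c (\<lambda>p. mul F c p k i j) \<and> holo c (\<lambda>p. unity F c p $ i) \<and>
     holo c (\<lambda>p. met F c p $ i $ j) \<and> holo c (\<lambda>p. euler F c p $ i))"

definition frobenius_algebra_at :: "('m, 'n::finite) frobenius \<Rightarrow> ('m, 'n) chart \<Rightarrow> 'm \<Rightarrow> bool" where
  "frobenius_algebra_at F c p \<longleftrightarrow>
     (\<forall>x y. vmul F c p x y = vmul F c p y x) \<and>
     (\<forall>x y z. vmul F c p (vmul F c p x y) z = vmul F c p x (vmul F c p y z)) \<and>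
     (\<forall>x. vmul F c p (unity F c p) x = x) \<and>
     (\<forall>x y. ip F c p x y = ip F c p y x) \<and>
     (\<forall>x. (\<forall>y. ip F c p x y = 0) \<longrightarrow> x = 0) \<and>
     (\<forall>x y z. ip F c p (vmul F c p x y) z = ip F c p x (vmul F c p y z))"

definition christoffel ::
  "('m, 'n::finite) frobenius \<Rightarrow> ('m, 'n) chart \<Rightarrow> 'n \<Rightarrow> 'n \<Rightarrow> 'n \<Rightarrow> 'm \<Rightarrow> complex" where
  "christoffel F c k i j p = (\<Sum>l\<in>UNIV. matrix_inv (met F c p) $ k $ l *
     (pd c i (\<lambda>q. met F c q $ j $ l) p + pd c j (\<lambda>q. met F c q $ i $ l) p
        - pd c l (\<lambda>q. met F c q $ i $ j) p)) / 2"

definition curvature ::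
  "('m, 'n::finite) frobenius \<Rightarrow> ('m, 'n) chart \<Rightarrow> 'n \<Rightarrow> 'n \<Rightarrow> 'n \<Rightarrow> 'n \<Rightarrow> 'm \<Rightarrow> complex" where
  "curvature F c l k i j p =
     pd c i (christoffel F c l j k) p - pd c j (christoffel F c l i k) p +
     (\<Sum>m\<in>UNIV. christoffel F c l i m p * christoffel F c m j k p
              - christoffel F c l j m p * christoffel F c m i k p)"

definition nabla_unity :: "('m, 'n::finite) frobenius \<Rightarrow> ('m, 'n) chart \<Rightarrow> 'n \<Rightarrow> 'n \<Rightarrow> 'm \<Rightarrow> complex" where
  "nabla_unity F c j k p =
     pd c j (\<lambda>q. unity F c q $ k) p + (\<Sum>i\<in>UNIV. christoffel F c k j i p * unity F c p $ i)"

definition ctensor :: "('m, 'n::finite) frobenius \<Rightarrow> ('m, 'n) chart \<Rightarrow> 'n \<Rightarrow> 'n \<Rightarrow> 'n \<Rightarrow> 'm \<Rightarrow> complex" where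
  "ctensor F c i j k p = ip F c p (vmul F c p (axis i 1) (axis j 1)) (axis k 1)"

text \<open>The first index of \<open>nabla_c\<close> is the direction of differentiation.\<close>

definition nabla_c ::
  "('m, 'n::finite) frobenius \<Rightarrow> ('m, 'n) chart \<Rightarrow> 'n \<Rightarrow> 'n \<Rightarrow> 'n \<Rightarrow> 'n \<Rightarrow> 'm \<Rightarrow> complex" where
  "nabla_c F c l i j k p = pd c l (ctensor F c i j k) p -
     (\<Sum>s\<in>UNIV. christoffel F c s l i p * ctensor F c s j k p +
               christoffel F c s l j p * ctensor F c i s k p +
               christoffel F c s l k p * ctensor F c i j s p)"

definition frobenius_manifold ::
  "('m::{t2_space, second_countable_topology}, 'n::finite) frobenius \<Rightarrow> complex \<Rightarrow> bool" where
  "frobenius_manifold F D \<longleftrightarrow>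
     complex_manifold (points F) (charts F) \<and> tensorial F \<and> holomorphic_components F \<and>
     (\<forall>c\<in>charts F. \<forall>p\<in>dom_of c.
        frobenius_algebra_at F c p \<and>
        (\<forall>i j k l. curvature F c l k i j p = 0) \<and>
        (\<forall>j k. nabla_unity F c j k p = 0) \<and>
        (\<forall>l i j k. nabla_c F c l i j k p = nabla_c F c i l j k p \<and>
                   nabla_c F c l i j k p = nabla_c F c l j i k p \<and>
                   nabla_c F c l i j k p = nabla_c F c l i k j p) \<and>
        (\<forall>X Y. (\<forall>i. holo c (\<lambda>q. X q $ i)) \<and> (\<forall>i. holo c (\<lambda>q. Y q $ i)) \<longrightarrow>
           lie c (euler F c) (\<lambda>q. vmul F c q (X q) (Y q)) p
             - vmul F c p (lie c (euler F c) X p) (Y p)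
             - vmul F c p (X p) (lie c (euler F c) Y p) = vmul F c p (X p) (Y p) \<and>
           (\<Sum>l\<in>UNIV. euler F c p $ l * pd c l (\<lambda>q. ip F c q (X q) (Y q)) p)
             - ip F c p (lie c (euler F c) X p) (Y p)
             - ip F c p (X p) (lie c (euler F c) Y p) = (2 - D) * ip F c p (X p) (Y p)))"

definition flat_coordinates ::
  "('m, 'n::finite) frobenius \<Rightarrow> complex \<Rightarrow> ('m, 'n) chart \<Rightarrow> 'n \<Rightarrow> complex^'n^'n \<Rightarrow>
   ('n \<Rightarrow> complex) \<Rightarrow> ('n \<Rightarrow> complex) \<Rightarrow> bool" where
  "flat_coordinates F D c \<iota> \<eta> \<mu> r \<longleftrightarrow> c \<in> charts F \<and>
     (\<forall>p\<in>dom_of c. met F c p = \<eta> \<and> unity F c p = axis \<iota> 1 \<and>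
        (\<forall>\<beta>. euler F c p $ \<beta> = (1 - D / 2 - \<mu> \<beta>) * coord c p $ \<beta> + r \<beta>)) \<and>
     \<mu> \<iota> = - D / 2 \<and> r \<iota> = 0"

definition mult_matrix :: "('m, 'n::finite) frobenius \<Rightarrow> ('m, 'n) chart \<Rightarrow> 'm \<Rightarrow> 'n \<Rightarrow> complex^'n^'n" where
  "mult_matrix F c p \<alpha> = (\<chi> \<gamma> \<beta>. mul F c p \<gamma> \<alpha> \<beta>)"

definition euler_matrix :: "('m, 'n::finite) frobenius \<Rightarrow> ('m, 'n) chart \<Rightarrow> 'm \<Rightarrow> complex^'n^'n" where
  "euler_matrix F c p = (\<chi> \<alpha> \<beta>. \<Sum>\<rho>\<in>UNIV. euler F c p $ \<rho> * mul F c p \<alpha> \<rho> \<beta>)"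

definition grad :: "('m, 'n::finite) frobenius \<Rightarrow> ('m, 'n) chart \<Rightarrow> ('m \<Rightarrow> complex) \<Rightarrow> 'm \<Rightarrow> complex^'n" where
  "grad F c f p = matrix_inv (met F c p) *v (\<chi> i. pd c i f p)"

definition mscale :: "complex \<Rightarrow> complex^'n^'n \<Rightarrow> complex^'n::finite^'n" where
  "mscale a A = (\<chi> i j. a * A $ i $ j)"

definition diag_matrix :: "('n \<Rightarrow> complex) \<Rightarrow> complex^'n::finite^'n" where
  "diag_matrix d = (\<chi> i j. if i = j then d i else 0)"

definition mexp :: "complex^'n^'n \<Rightarrow> complex^'n::finite^'n" where
  "mexp A = (\<chi> i j. \<Sum>k. (((**) A) ^^ k) (mat 1) $ i $ j / fact k)"

text \<open>\<open>zpow l A\<close> is \<open>z\<close> to the power \<open>A\<close> for the value \<open>l\<close> of the logarithm of \<open>z\<close>.\<close>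

definition zpow :: "complex \<Rightarrow> complex^'n^'n \<Rightarrow> complex^'n::finite^'n" where
  "zpow l A = mexp (mscale l A)"

definition monodromy_exponents ::
  "complex^'n::finite^'n \<Rightarrow> ('n \<Rightarrow> complex) \<Rightarrow> complex^'n^'n \<Rightarrow> (nat \<Rightarrow> complex^'n^'n) \<Rightarrow> bool" where
  "monodromy_exponents \<eta> \<mu> R Rs \<longleftrightarrow>
     Rs 0 = 0 \<and> finite {s. Rs s \<noteq> 0} \<and> R = (\<Sum>s | Rs s \<noteq> 0. Rs s) \<and>
     (\<forall>l. zpow l (diag_matrix \<mu>) ** R ** zpow l (- diag_matrix \<mu>) =
          (\<Sum>s | Rs s \<noteq> 0. mscale (exp l ^ s) (Rs s))) \<and>
     (\<forall>s\<ge>1. matrix_inv \<eta> ** transpose (Rs s) ** \<eta> = mscale ((-1) ^ (s + 1)) (Rs s))"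

definition analytic_on_times_plane ::
  "('m, 'n::finite) chart \<Rightarrow> ('m \<Rightarrow> complex \<Rightarrow> complex) \<Rightarrow> bool" where
  "analytic_on_times_plane c f \<longleftrightarrow> (\<forall>x\<in>coord c ` dom_of c. \<forall>z. \<exists>(a::complex^'n) b.
     ((\<lambda>(y, w). f (point_at c y) w) has_derivative (\<lambda>(h, k). (\<Sum>i\<in>UNIV. a $ i * h $ i) + b * k)) (at (x, z)))"

text \<open>
  The multivalued matrix \<open>T z\<^sup>\<mu> z\<^sup>R\<close> is required to be a fundamental solution for every holomorphic
  branch \<open>L\<close> of the logarithm on an open set \<open>W\<close>.
\<close>

definition fundamental_solution ::
  "('m, 'n::finite) frobenius \<Rightarrow> ('m, 'n) chart \<Rightarrow> complex^'n^'n \<Rightarrow> ('n \<Rightarrow> complex) \<Rightarrow> complex^'n^'n \<Rightarrow>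
   ('m \<Rightarrow> complex \<Rightarrow> complex^'n^'n) \<Rightarrow> bool" where
  "fundamental_solution F c \<eta> \<mu> R T \<longleftrightarrow>
     (\<forall>i j. analytic_on_times_plane c (\<lambda>p z. T p z $ i $ j)) \<and>
     (\<forall>p\<in>dom_of c. T p 0 = mat 1) \<and>
     (\<forall>p\<in>dom_of c. \<forall>z. matrix_inv \<eta> ** transpose (T p (- z)) ** \<eta> ** T p z = mat 1) \<and>
     (\<forall>W L. open W \<and> L holomorphic_on W \<and> (\<forall>z\<in>W. exp (L z) = z) \<longrightarrow>
        (let Y = (\<lambda>p z. T p z ** zpow (L z) (diag_matrix \<mu>) ** zpow (L z) R)
         in \<forall>p\<in>dom_of c. \<forall>z\<in>W.
              det (Y p z) \<noteq> 0 \<and>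
              (\<forall>i j \<alpha>. pd c \<alpha> (\<lambda>q. Y q z $ i $ j) p = z * (mult_matrix F c p \<alpha> ** Y p z) $ i $ j) \<and>
              (\<forall>i j. ((\<lambda>w. Y p w $ i $ j) has_field_derivative
                 ((euler_matrix F c p + mscale (1 / z) (diag_matrix \<mu>)) ** Y p z) $ i $ j) (at z))))"

definition monodromy_data ::
  "('m, 'n::finite) frobenius \<Rightarrow> ('m, 'n) chart \<Rightarrow> complex^'n^'n \<Rightarrow> ('n \<Rightarrow> complex) \<Rightarrow> complex^'n^'n \<Rightarrow>
   (nat \<Rightarrow> complex^'n^'n) \<Rightarrow> bool" where
  "monodromy_data F c \<eta> \<mu> R Rs \<longleftrightarrow>
     monodromy_exponents \<eta> \<mu> R Rs \<and> (\<exists>T. fundamental_solution F c \<eta> \<mu> R T)"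

definition grad_series ::
  "('m, 'n::finite) frobenius \<Rightarrow> ('m, 'n) chart \<Rightarrow> (nat \<Rightarrow> 'm \<Rightarrow> complex) \<Rightarrow> 'm \<Rightarrow> 'n \<Rightarrow> complex fps" where
  "grad_series F c f p \<gamma> = Abs_fps (\<lambda>m. grad F c (f m) p $ \<gamma>)"

definition calibration ::
  "('m, 'n::finite) frobenius \<Rightarrow> ('m, 'n) chart \<Rightarrow> 'n \<Rightarrow> complex^'n^'n \<Rightarrow> ('n \<Rightarrow> complex) \<Rightarrow>
   (nat \<Rightarrow> complex^'n^'n) \<Rightarrow> ('n \<Rightarrow> nat \<Rightarrow> 'm \<Rightarrow> complex) \<Rightarrow> bool" where
  "calibration F c \<iota> \<eta> \<mu> Rs \<theta> \<longleftrightarrow>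
     (\<forall>\<alpha> m. holo c (\<theta> \<alpha> m)) \<and>
     (\<forall>p\<in>dom_of c.
       (\<forall>\<alpha>. \<theta> \<alpha> 0 p = (\<Sum>\<rho>\<in>UNIV. \<eta> $ \<alpha> $ \<rho> * coord c p $ \<rho>)) \<and>
       (\<forall>\<alpha> \<beta> \<gamma> m. pd c \<alpha> (pd c \<beta> (\<theta> \<gamma> (Suc m))) p =
          (\<Sum>\<sigma>\<in>UNIV. mul F c p \<sigma> \<alpha> \<beta> * pd c \<sigma> (\<theta> \<gamma> m) p)) \<and>
       (\<forall>\<alpha> \<beta>. (\<Sum>\<rho>\<in>UNIV. \<Sum>\<sigma>\<in>UNIV. fps_const (met F c p $ \<rho> $ \<sigma>) *
             grad_series F c (\<theta> \<alpha>) p \<rho> * fps_compose (grad_series F c (\<theta> \<beta>) p \<sigma>) (- fps_X)) =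
          fps_const (\<eta> $ \<alpha> $ \<beta>)) \<and>
       (\<forall>\<alpha> m. pd c \<iota> (\<theta> \<alpha> (Suc m)) p = \<theta> \<alpha> m p) \<and>
       (\<forall>\<alpha> \<beta> m. (\<Sum>\<rho>\<in>UNIV. euler F c p $ \<rho> * pd c \<rho> (pd c \<beta> (\<theta> \<alpha> m)) p) =
          (of_nat m + \<mu> \<alpha> + \<mu> \<beta>) * pd c \<beta> (\<theta> \<alpha> m) p +
          (\<Sum>\<gamma>\<in>UNIV. \<Sum>k=1..m. Rs k $ \<gamma> $ \<alpha> * pd c \<beta> (\<theta> \<gamma> (m - k)) p)))"

definition calibrates ::
  "('m, 'n::finite) chart \<Rightarrow> complex^'n^'n \<Rightarrow> ('n \<Rightarrow> nat \<Rightarrow> 'm \<Rightarrow> complex) \<Rightarrow>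
   ('m \<Rightarrow> complex \<Rightarrow> complex^'n^'n) \<Rightarrow> bool" where
  "calibrates c \<eta> \<theta> T \<longleftrightarrow> (\<forall>p\<in>dom_of c. \<forall>z \<alpha> \<beta>.
     (\<lambda>m. (\<Sum>\<gamma>\<in>UNIV. matrix_inv \<eta> $ \<alpha> $ \<gamma> * pd c \<gamma> (\<theta> \<beta> m) p) * z ^ m) sums (T p z $ \<alpha> $ \<beta>))"

text \<open>
  The quotient by \<open>z + w\<close> is taken in power series in \<open>z\<close> with coefficients power series in \<open>w\<close>, an
  integral domain; it exists because of the orthogonality relation for calibrations.
\<close>

definition two_point ::
  "('m, 'n::finite) frobenius \<Rightarrow> ('m, 'n) chart \<Rightarrow> complex^'n^'n \<Rightarrow> ('n \<Rightarrow> nat \<Rightarrow> 'm \<Rightarrow> complex) \<Rightarrow>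
   'n \<Rightarrow> nat \<Rightarrow> 'n \<Rightarrow> nat \<Rightarrow> 'm \<Rightarrow> complex" where
  "two_point F c \<eta> \<theta> \<alpha> m\<^sub>1 \<beta> m\<^sub>2 p =
     fps_nth (fps_nth (THE Q :: complex fps fps. (fps_X + fps_const fps_X) * Q =
       Abs_fps (\<lambda>i. Abs_fps (\<lambda>j. ip F c p (grad F c (\<theta> \<alpha> i) p) (grad F c (\<theta> \<beta> j) p))) -
       fps_const (fps_const (\<eta> $ \<alpha> $ \<beta>))) m\<^sub>1) m\<^sub>2"

text \<open>\<open>coord_vec c \<kappa> d p\<close> consists of the components in the chart \<open>d\<close> of the \<open>\<kappa>\<close>-th coordinate vector field of \<open>c\<close>.\<close>

definition coord_vec :: "('m, 'n::finite) chart \<Rightarrow> 'n \<Rightarrow> ('m, 'n) chart \<Rightarrow> 'm \<Rightarrow> complex^'n" where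
  "coord_vec c \<kappa> d p = jac c d p *v axis \<kappa> 1"

definition legendre ::
  "('m, 'n::finite) frobenius \<Rightarrow> ('m, 'n) chart \<Rightarrow> 'n \<Rightarrow> ('m, 'n) frobenius" where
  "legendre F c \<kappa> =
     \<lparr>points = dom_of c, charts = {d \<in> charts F. dom_of d \<subseteq> dom_of c},
      mul = mul F, unity = unity F,
      met = (\<lambda>d p. \<chi> i j. ip F d p (vmul F d p (coord_vec c \<kappa> d p) (axis i 1))
                                   (vmul F d p (coord_vec c \<kappa> d p) (axis j 1))),
      euler = euler F\<rparr>"

definition legendre_coord ::
  "('m, 'n::finite) frobenius \<Rightarrow> ('m, 'n) chart \<Rightarrow> complex^'n^'n \<Rightarrow> ('n \<Rightarrow> nat \<Rightarrow> 'm \<Rightarrow> complex) \<Rightarrow> 'n \<Rightarrow>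
   'm \<Rightarrow> complex^'n" where
  "legendre_coord F c \<eta> \<theta> \<kappa> p = (\<chi> \<alpha>. \<Sum>\<beta>\<in>UNIV. matrix_inv \<eta> $ \<alpha> $ \<beta> * two_point F c \<eta> \<theta> \<beta> 0 \<kappa> 0 p)"

definition shrink :: "('m, 'n::finite) chart \<Rightarrow> complex^'n \<Rightarrow> real \<Rightarrow> ('m, 'n) chart" where
  "shrink c a \<epsilon> = ({p \<in> dom_of c. coord c p \<in> ball a \<epsilon>}, coord c)"

end

theory Submission
  imports Defs "HOL-Complex_Analysis.Cauchy_Integral_Formula"
begin

text \<open>
  The orthogonality relation makes the two-point functions well defined, and their first column is
  \<open>\<Omega>(\<alpha>, m; \<kappa>, 0) = \<partial>\<^sub>\<kappa> \<theta>(\<alpha>, m + 1)\<close>, because the gradient of \<open>\<theta>(\<kappa>, 0)\<close> is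
  \<open>\<partial>\<^sub>\<kappa>\<close>. By the second-order equations for the calibration, the Jacobian of the new coordinates is the
  matrix \<open>C\<close> of multiplication by \<open>\<partial>\<^sub>\<kappa>\<close>, and the derivatives of \<open>\<partial>\<^sub>\<kappa> \<theta>(\<alpha>, m + 1)\<close> in the old
  coordinates are those of \<open>\<theta>(\<alpha>, m)\<close> multiplied by \<open>C\<close>. Hence the \<open>\<gamma>\<close>-th derivative of the new
  calibration in the new coordinates equals that of the old calibration in the old ones, so the
  same matrix \<open>T\<close> is a fundamental solution for both manifolds. Multiplication by the Euler field commutes with
  \<open>C\<close> and therefore has the same matrix in both coordinate systems.
\<close>

section \<open>Derivatives of functions of several complex variables\<close>

text \<open>An invertible Jacobian makes the new coordinates injective only locally, so they need
  not be a chart on all of \<open>c\<close>. This is why restriction to concentric balls has to be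
  carried through every notion. Once injectivity holds, maximality of the atlas puts the new chart
  among the charts of the original manifold, and the tensor law delivers product, unity, metric and
  Euler field there. Two facts about the exponents enter through the new Euler field. Raising an
  index must turn \<mu> into its negative, which is read off from the homogeneity of the metric
  under the Euler field. The normalisation of flat coordinates demands that the constant term vanish
  in the unity direction, that is, that the \<kappa>-th diagonal entry of \<open>Rs 1\<close> be
  zero; this holds because conjugation by a diagonal matrix fixes the diagonal of \<open>R\<close>.
  Holomorphy is encoded as complex differentiability at each point, while the calibration involves
  second derivatives. The missing regularity comes from the one-variable Cauchy formula along each
  coordinate axis.\<close>

lemma matrix_inv:
  fixes A :: "'a::field^'n^'n"
  assumes "invertible A"
  shows "A ** matrix_inv A = mat 1" "matrix_inv A ** A = mat 1"
proof -
  have "\<exists>A'. A ** A' = mat 1 \<and> A' ** A = mat 1"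
    using assms by (simp add: invertible_def)
  then have "A ** matrix_inv A = mat 1 \<and> matrix_inv A ** A = mat 1"
    unfolding matrix_inv_def by (rule someI_ex)
  then show "A ** matrix_inv A = mat 1" "matrix_inv A ** A = mat 1" by auto
qed

lemma matrix_inv_cancel:
  fixes A :: "'a::field^'n^'n"
  assumes "invertible A"
  shows "A *v (matrix_inv A *v x) = x" "matrix_inv A *v (A *v x) = x"
  by (simp_all add: matrix_vector_mul_assoc matrix_inv assms)

lemma bounded_linear_matrix_vector: "bounded_linear ((*v) (A::complex^'n^'m))"
  unfolding linear_conv_bounded_linear[symmetric]
  by (rule linearI) (auto simp: vec_eq_iff matrix_vector_mult_def algebra_simps sum.distrib scaleR_sum_right)

lemma bounded_linear_axis: "bounded_linear (axis i :: complex \<Rightarrow> complex^'n)"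
  unfolding linear_conv_bounded_linear[symmetric]
  by (rule linearI) (auto simp: vec_eq_iff axis_def)

lemma scale_axis: "t *s axis i 1 = (axis i t :: complex^'n)"
  by (auto simp: vec_eq_iff axis_def)

lemma sum_axis: "(\<Sum>i\<in>UNIV. axis i (x $ i)) = (x :: complex^'n)"
  by (simp add: vec_eq_iff axis_def if_distrib sum.If_cases)

lemma sum_mult_axis: "(\<Sum>j\<in>UNIV. f j * axis i x $ j) = f i * (x::complex)"
proof -
  have "(\<Sum>j\<in>UNIV. f j * axis i x $ j) = (\<Sum>j\<in>UNIV. if j = i then f j * x else 0)"
    by (intro sum.cong) (auto simp: axis_def)
  then show ?thesis by simp
qed

lemma has_derivative_vec:
  fixes f :: "'a::real_normed_vector \<Rightarrow> complex^'n"
  assumes "\<And>i. ((\<lambda>x. f x $ i) has_derivative (\<lambda>h. f' h $ i)) F"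
  shows "(f has_derivative f') F"
proof -
  have "((\<lambda>x. \<Sum>i\<in>UNIV. axis i (f x $ i)) has_derivative (\<lambda>h. \<Sum>i\<in>UNIV. axis i (f' h $ i))) F"
    by (intro has_derivative_sum bounded_linear.has_derivative[OF bounded_linear_axis] assms)
  then show ?thesis by (simp add: sum_axis)
qed

lemma has_derivative_nth:
  fixes f :: "'a::real_normed_vector \<Rightarrow> complex^'n"
  assumes "(f has_derivative f') F"
  shows "((\<lambda>x. f x $ i) has_derivative (\<lambda>h. f' h $ i)) F"
  using assms by (rule bounded_linear.has_derivative[OF bounded_linear_vec_nth])

text \<open>A one-variable complex derivative along an axis, so that one-variable Cauchy theory
  applies; \<open>pd\<close> is this derivative read in a chart.\<close>

definition partial :: "'n \<Rightarrow> (complex^'n::finite \<Rightarrow> complex) \<Rightarrow> complex^'n \<Rightarrow> complex" where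
  "partial i f x = deriv (\<lambda>t. f (x + axis i t)) 0"

lemma has_derivative_along_axis:
  fixes x :: "complex^'n"
  assumes "(f has_derivative (\<lambda>h. \<Sum>j\<in>UNIV. a $ j * h $ j)) (at (x + axis i t))"
  shows "((\<lambda>t. f (x + axis i t)) has_field_derivative a $ i) (at t)"
proof -
  have "((\<lambda>t. x + axis i t) has_derivative axis i) (at t)"
    using bounded_linear_imp_has_derivative[OF bounded_linear_axis, of i "at t"]
    by (auto intro!: derivative_eq_intros)
  from has_derivative_compose[OF this assms]
  have "((\<lambda>t. f (x + axis i t)) has_derivative (\<lambda>t. a $ i * t)) (at t)"
    by (simp add: sum_mult_axis)
  then show ?thesis by (simp add: has_field_derivative_def)
qed

lemma partial_eq:
  assumes "(f has_derivative (\<lambda>h. \<Sum>j\<in>UNIV. a $ j * h $ j)) (at x)"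
  shows "partial i f x = a $ i"
  unfolding partial_def using assms has_derivative_along_axis[of f a x i 0]
  by (intro DERIV_imp_deriv) (simp add: axis_def zero_vec_def[symmetric])

lemma hol_on_has_derivative:
  assumes "hol_on f S" "x \<in> S"
  shows "(f has_derivative (\<lambda>h. \<Sum>i\<in>UNIV. partial i f x * h $ i)) (at x)"
proof -
  obtain a :: "complex^'a" where a: "(f has_derivative (\<lambda>h. \<Sum>i\<in>UNIV. a $ i * h $ i)) (at x)"
    using assms unfolding hol_on_def by blast
  then show ?thesis using partial_eq[OF a] by simp
qed

lemma hol_onI:
  assumes "\<And>x. x \<in> S \<Longrightarrow> (f has_derivative (\<lambda>h. \<Sum>i\<in>UNIV. a x $ i * h $ i)) (at x)"
  shows "hol_on f S"
  unfolding hol_on_def using assms by blast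

lemma pd_partial: "pd c i f p = partial i (\<lambda>x. f (point_at c x)) (coord c p)"
  by (simp add: pd_def partial_def scale_axis)

lemma hol_on_cong:
  assumes "open S" "\<And>x. x \<in> S \<Longrightarrow> f x = g x" "hol_on f S"
  shows "hol_on g S"
proof (rule hol_onI)
  fix x assume x: "x \<in> S"
  show "(g has_derivative (\<lambda>h. \<Sum>i\<in>UNIV. (\<chi> i. partial i f x) $ i * h $ i)) (at x)"
    using has_derivative_transform_within_open[OF hol_on_has_derivative[OF assms(3) x] assms(1) x] assms(2)
    by simp
qed

lemma partial_cong:
  assumes "open S" "\<And>x. x \<in> S \<Longrightarrow> f x = g x" "x \<in> S"
  shows "partial i f x = partial i g x"
  unfolding partial_def
proof (rule deriv_cong_ev)
  have "isCont (\<lambda>t. x + axis i t) 0"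
    using linear_continuous_at[OF bounded_linear_axis] by (intro continuous_intros) auto
  then have "((\<lambda>t. x + axis i t) \<longlongrightarrow> x) (nhds 0)"
    by (simp add: isCont_def axis_def zero_vec_def[symmetric] tendsto_nhds_iff)
  then have "\<forall>\<^sub>F t in nhds 0. x + axis i t \<in> S"
    using assms(1,3) by (rule topological_tendstoD)
  then show "\<forall>\<^sub>F t in nhds 0. f (x + axis i t) = g (x + axis i t)"
    by eventually_elim (simp add: assms(2))
qed simp

lemma hol_on_const: "hol_on (\<lambda>x. k) S"
  by (rule hol_onI[where a="\<lambda>_. 0"]) simp

lemma hol_on_add:
  assumes "hol_on f S" "hol_on g S"
  shows "hol_on (\<lambda>x. f x + g x) S"
proof (rule hol_onI)
  fix x assume "x \<in> S"
  then show "((\<lambda>x. f x + g x) has_derivative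
      (\<lambda>h. \<Sum>i\<in>UNIV. (\<chi> i. partial i f x + partial i g x) $ i * h $ i)) (at x)"
    using has_derivative_add[OF hol_on_has_derivative[OF assms(1)] hol_on_has_derivative[OF assms(2)]]
    by (simp add: algebra_simps sum.distrib)
qed

lemma hol_on_cmult:
  assumes "hol_on f S"
  shows "hol_on (\<lambda>x. k * f x) S"
proof (rule hol_onI)
  fix x assume "x \<in> S"
  then show "((\<lambda>x. k * f x) has_derivative
      (\<lambda>h. \<Sum>i\<in>UNIV. (\<chi> i. k * partial i f x) $ i * h $ i)) (at x)"
    using has_derivative_mult_right[OF hol_on_has_derivative[OF assms(1)], of x k]
    by (simp add: algebra_simps sum_distrib_left)
qed

lemma hol_on_sum:
  assumes "\<And>i. i \<in> A \<Longrightarrow> hol_on (f i) S"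
  shows "hol_on (\<lambda>x. \<Sum>i\<in>A. f i x) S"
  using assms by (induction A rule: infinite_finite_induct) (auto intro: hol_on_const hol_on_add)

lemma hol_on_continuous_on: "hol_on f S \<Longrightarrow> continuous_on S f"
  by (meson continuous_at_imp_continuous_on has_derivative_continuous hol_on_has_derivative)

lemma hol_on_subset: "hol_on f S \<Longrightarrow> T \<subseteq> S \<Longrightarrow> hol_on f T"
  unfolding hol_on_def by blast

text \<open>Stated with an integral over a real interval, so that continuity and differentiability in \<open>x\<close>
  follow from the theorems on integrals depending on a parameter.\<close>

lemma partial_Cauchy:
  assumes f: "hol_on f S" and r: "r > 0" and sub: "\<And>t. cmod t \<le> r \<Longrightarrow> x + axis i t \<in> S"
  shows "partial i f x = integral (cbox 0 1) (\<lambda>s. f (x + axis i (r * exp (2 * pi * \<i> * of_real s))) / (r * exp (2 * pi * \<i> * of_real s)))"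
proof -
  define g where "g t = f (x + axis i t)" for t
  have d: "(g has_field_derivative partial i f (x + axis i t)) (at t)" if "cmod t \<le> r" for t
    using has_derivative_along_axis[of f "\<chi> j. partial j f (x + axis i t)" x i t]
      hol_on_has_derivative[OF f sub[OF that]]
    by (simp add: g_def[abs_def])
  have c: "continuous_on (cball 0 r) g"
    by (rule DERIV_continuous_on) (auto intro: d[THEN has_field_derivative_at_within])
  have h: "g holomorphic_on ball 0 r"
    by (auto simp: holomorphic_on_open intro!: exI d)
  have w: "0 \<in> ball 0 r" using r by simp
  have "partial i f x = deriv g 0" by (simp add: partial_def g_def[abs_def])
  also have "\<dots> = 1 / (2 * of_real pi * \<i>) * contour_integral(circlepath 0 r) (\<lambda>u. g u / (u - 0)^2)"
    by (rule DERIV_imp_deriv, rule Cauchy_derivative_integral_circlepath(2)[OF c h w])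
  also have "contour_integral(circlepath 0 r) (\<lambda>u. g u / (u - 0)^2) =
    integral {0..1} (\<lambda>s. g (circlepath 0 r s) / (circlepath 0 r s - 0)^2 * vector_derivative (circlepath 0 r) (at s))"
    by (rule contour_integral_integral)
  \<comment> \<open>The velocity of the circle is 2 pi i times its position, which cancels one of
    the two powers in the denominator.\<close>
  also have "\<dots> = integral {0..1} (\<lambda>s. (2 * pi * \<i>) * (g (r * exp (2 * pi * \<i> * of_real s)) / (r * exp (2 * pi * \<i> * of_real s))))"
  proof (rule integral_cong)
    fix s :: real assume s: "s \<in> {0..1}"
    show "g (circlepath 0 r s) / (circlepath 0 r s - 0)^2 * vector_derivative (circlepath 0 r) (at s) = (2 * pi * \<i>) * (g (r * exp (2 * pi * \<i> * of_real s)) / (r * exp (2 * pi * \<i> * of_real s)))"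
      unfolding vector_derivative_circlepath
      using r by (simp add: circlepath power2_eq_square field_simps)
  qed
  finally show ?thesis unfolding integral_mult_right by (simp add: g_def)
qed

lemma norm_axis: "norm (axis i t :: complex^'n) = norm t"
  by (simp add: norm_eq_sqrt_inner inner_axis_axis)

lemma complex_linear_eq_sum:
  fixes L :: "complex^'n \<Rightarrow> complex"
  assumes "linear L" "\<And>t h. L (t *s h) = t * L h"
  shows "L h = (\<Sum>i\<in>UNIV. L (axis i 1) * h $ i)"
proof -
  have "L h = L (\<Sum>i\<in>UNIV. h $ i *s axis i 1)" by (simp add: basis_expansion)
  also have "\<dots> = (\<Sum>i\<in>UNIV. L (axis i 1) * h $ i)"
    by (simp add: linear_sum[OF assms(1)] assms(2) mult.commute)
  finally show ?thesis .
qed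

section \<open>Regularity of first partial derivatives\<close>

definition circ :: "real \<Rightarrow> real \<Rightarrow> complex" where
  "circ r s = r * exp (2 * pi * \<i> * of_real s)"

lemma norm_circ: "r > 0 \<Longrightarrow> cmod (circ r s) = r"
  by (simp add: circ_def norm_mult)

lemma circ_nonzero: "r > 0 \<Longrightarrow> circ r s \<noteq> 0"
  by (simp add: circ_def)

lemma continuous_on_circ [continuous_intros]:
  "continuous_on S g \<Longrightarrow> continuous_on S (\<lambda>x. circ r (g x))"
  unfolding circ_def by (intro continuous_intros)

lemma continuous_on_axis [continuous_intros]:
  "continuous_on S g \<Longrightarrow> continuous_on S (\<lambda>x. axis i (g x) :: complex^'n)"
  using bounded_linear.continuous_on[OF bounded_linear_axis] .

text \<open>One radius serves all base points near \<open>x0\<close>, so that Cauchy's formula holds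
  there over a fixed circle and can be treated as an integral with parameter
  \<open>x\<close>.\<close>

lemma open_polydisc:
  fixes x0 :: "complex^'n"
  assumes "open S" "x0 \<in> S"
  obtains r where "r > 0" "\<And>x i t. x \<in> ball x0 r \<Longrightarrow> cmod t \<le> r \<Longrightarrow> x + axis i t \<in> S"
proof -
  obtain e where e: "e > 0" "ball x0 e \<subseteq> S" using assms open_contains_ball by blast
  show ?thesis
  proof (rule that[of "e / 2"])
    fix x :: "complex^'n" and i t assume *: "x \<in> ball x0 (e / 2)" "cmod t \<le> e / 2"
    have "dist x0 (x + axis i t) \<le> dist x0 x + norm (axis i t :: complex^'n)"
      by (metis add.commute add_diff_cancel_right' dist_norm dist_triangle norm_minus_commute)
    then have "dist x0 (x + axis i t) < e" using * by (simp add: norm_axis)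
    then show "x + axis i t \<in> S" using e by auto
  qed (use e in simp)
qed

lemma continuous_on_shifted:
  fixes f :: "complex^'n \<Rightarrow> 'a::topological_space"
  assumes "continuous_on S f" "r > 0"
    and "\<And>x t. x \<in> U \<Longrightarrow> cmod t \<le> r \<Longrightarrow> x + axis i t \<in> S"
  shows "continuous_on (U \<times> T) (\<lambda>z. f (fst z + axis i (circ r (snd z))))"
  by (rule continuous_on_compose2[OF assms(1)])
     (auto intro!: continuous_intros assms(3) simp: norm_circ assms(2))

text \<open>Cauchy's formula with a fixed radius has an integrand that is jointly continuous in the
  point and the angle, so its integral is continuous in the point.\<close>

lemma continuous_on_partial:
  assumes "open S" "hol_on f S"
  shows "continuous_on S (partial i f)"
proof (rule continuous_at_imp_continuous_on, rule ballI)
  fix x0 assume "x0 \<in> S"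
  then obtain r where r: "r > 0" "\<And>x i t. x \<in> ball x0 r \<Longrightarrow> cmod t \<le> r \<Longrightarrow> x + axis i t \<in> S"
    using open_polydisc[OF assms(1)] by metis
  have "continuous_on (ball x0 r \<times> cbox 0 1) (\<lambda>(x, s). f (x + axis i (circ r s)) / circ r s)"
    unfolding split_beta
    by (intro continuous_intros continuous_on_shifted[OF hol_on_continuous_on[OF assms(2)]])
       (auto simp: r circ_nonzero)
  then have "continuous_on (ball x0 r) (\<lambda>x. integral (cbox 0 1) (\<lambda>s. f (x + axis i (circ r s)) / circ r s))"
    by (rule integral_continuous_on_param)
  then have "continuous_on (ball x0 r) (partial i f)"
    by (rule continuous_on_eq) (simp add: partial_Cauchy[OF assms(2) r(1) r(2)] circ_def)
  then show "isCont (partial i f) x0"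
    using r(1) by (simp add: continuous_on_eq_continuous_at)
qed

text \<open>The total derivative packaged as a bounded linear map: differentiation under the
  integral sign asks for a derivative that is continuous in operator norm.\<close>

definition dblinfun :: "(complex^'n::finite \<Rightarrow> complex) \<Rightarrow> complex^'n \<Rightarrow> (complex^'n) \<Rightarrow>\<^sub>L complex" where
  "dblinfun f x = (\<Sum>j\<in>UNIV. blinfun_mult_right (partial j f x) o\<^sub>L Blinfun (\<lambda>h. h $ j))"

lemma dblinfun_apply: "blinfun_apply (dblinfun f x) h = (\<Sum>j\<in>UNIV. partial j f x * h $ j)"
  by (simp add: dblinfun_def blinfun.sum_left bounded_linear_Blinfun_apply bounded_linear_vec_nth)

lemma continuous_on_dblinfun:
  assumes "open S" "hol_on f S"
  shows "continuous_on S (dblinfun f)"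
  unfolding dblinfun_def
  by (intro continuous_intros continuous_on_partial assms)

text \<open>Cauchy's formula is differentiated under the integral sign, which is legitimate because
  the first partial derivatives are already known to be continuous. Iterating the result yields the
  second derivatives that occur in a calibration.\<close>

theorem hol_on_partial:
  assumes S: "open S" and f: "hol_on f S"
  shows "hol_on (partial i f) S"
  unfolding hol_on_def
proof
  fix x0 assume x0: "x0 \<in> S"
  then obtain r where r: "r > 0" "\<And>x i t. x \<in> ball x0 r \<Longrightarrow> cmod t \<le> r \<Longrightarrow> x + axis i t \<in> S"
    using open_polydisc[OF assms(1)] by metis
  define k where "k x s = f (x + axis i (circ r s)) / circ r s" for x s
  define k' where "k' x s = blinfun_mult_right (1 / circ r s) o\<^sub>L dblinfun f (x + axis i (circ r s))" for x s
  have in_S: "x + axis i (circ r s) \<in> S" if "x \<in> ball x0 r" for x s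
    using r that by (simp add: norm_circ)
  have der: "((\<lambda>x. k x s) has_derivative blinfun_apply (k' x s)) (at x within ball x0 r)"
    if "x \<in> ball x0 r" for x s
  proof -
    have "((\<lambda>x. f (x + axis i (circ r s))) has_derivative
        (\<lambda>h. \<Sum>j\<in>UNIV. partial j f (x + axis i (circ r s)) * h $ j)) (at x within ball x0 r)"
      by (rule has_derivative_compose[where g=f and f="\<lambda>x. x + axis i (circ r s)", OF _ hol_on_has_derivative[OF f in_S[OF that]]])
         (auto intro!: derivative_eq_intros)
    moreover have "blinfun_apply (k' x s) =
        (\<lambda>h. 1 / circ r s * (\<Sum>j\<in>UNIV. partial j f (x + axis i (circ r s)) * h $ j))"
      by (rule ext) (simp add: k'_def dblinfun_apply)
    ultimately show ?thesis
      using has_derivative_mult_right[of _ _ _ "1 / circ r s"] by (fastforce simp: k_def)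
  qed
  have cont_k: "continuous_on (ball x0 r \<times> cbox 0 1) (\<lambda>(x, s). k x s)"
    unfolding split_beta k_def
    by (intro continuous_intros continuous_on_shifted[OF hol_on_continuous_on[OF f]])
       (auto simp: r circ_nonzero)
  have int_k: "k x integrable_on cbox 0 1" if "x \<in> ball x0 r" for x
  proof (rule integrable_continuous)
    have "continuous_on (cbox 0 1) (\<lambda>s. case (x, s) of (x, s) \<Rightarrow> k x s)"
      by (rule continuous_on_compose2[OF cont_k])
         (use that in \<open>auto intro!: continuous_on_Pair continuous_on_const continuous_on_id\<close>)
    then show "continuous_on (cbox 0 1) (k x)" by simp
  qed
  have cont_k': "continuous_on (ball x0 r \<times> cbox 0 1) (\<lambda>(x, s). k' x s)"
    unfolding split_beta k'_def
    by (intro continuous_intros continuous_on_shifted[OF continuous_on_dblinfun[OF S f]])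
       (auto simp: r circ_nonzero)
  have int_k': "k' x0 integrable_on cbox 0 1"
  proof (rule integrable_continuous)
    have "continuous_on (cbox 0 1) (\<lambda>s. case (x0, s) of (x, s) \<Rightarrow> k' x s)"
      by (rule continuous_on_compose2[OF cont_k'])
         (use r(1) in \<open>auto intro!: continuous_on_Pair continuous_on_const continuous_on_id\<close>)
    then show "continuous_on (cbox 0 1) (k' x0)" by simp
  qed
  have "((\<lambda>x. integral (cbox 0 1) (k x)) has_derivative integral (cbox 0 1) (k' x0)) (at x0 within ball x0 r)"
    using r(1) by (intro leibniz_rule der int_k cont_k') auto
  then have "((\<lambda>x. integral (cbox 0 1) (k x)) has_derivative integral (cbox 0 1) (k' x0)) (at x0)"
    using r(1) by (simp add: at_within_open[of x0 "ball x0 r"])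
  then have "(partial i f has_derivative integral (cbox 0 1) (k' x0)) (at x0)"
    by (rule has_derivative_transform_within_open[OF _ open_ball[of x0 r]])
       (use r in \<open>auto simp: partial_Cauchy[OF f r(1) r(2)] circ_def k_def[abs_def]\<close>)
  \<comment> \<open>The derivative obtained is a priori only real linear. For each angle the
    integrand is complex linear, and this passes to the integral, so that the coefficients demanded
    by \<open>hol_on\<close> are the values on the basis vectors.\<close>
  moreover have eq: "blinfun_apply (integral (cbox 0 1) (k' x0)) h =
      (\<Sum>j\<in>UNIV. blinfun_apply (integral (cbox 0 1) (k' x0)) (axis j 1) * h $ j)" for h
  proof (rule complex_linear_eq_sum)
    show "linear (blinfun_apply (integral (cbox 0 1) (k' x0)))"
      by (simp add: blinfun.bounded_linear_right bounded_linear.linear)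
    fix t h
    have "k' x0 s (t *s h) = t * k' x0 s h" for s
      by (simp add: k'_def dblinfun_apply sum_distrib_left algebra_simps)
    then show "blinfun_apply (integral (cbox 0 1) (k' x0)) (t *s h) =
        t * blinfun_apply (integral (cbox 0 1) (k' x0)) h"
      unfolding blinfun_apply_integral[OF int_k'] by simp
  qed
  ultimately have "(partial i f has_derivative
      (\<lambda>h. \<Sum>j\<in>UNIV. blinfun_apply (integral (cbox 0 1) (k' x0)) (axis j 1) * h $ j)) (at x0)"
    by (rule has_derivative_eq_rhs[OF _ ext])
  then show "\<exists>a::complex^'a. (partial i f has_derivative (\<lambda>h. \<Sum>j\<in>UNIV. a $ j * h $ j)) (at x0)"
    by (intro exI[of _ "\<chi> j. blinfun_apply (integral (cbox 0 1) (k' x0)) (axis j 1)"])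
       (simp only: vec_lambda_beta)
qed

section \<open>Charts and coordinate changes\<close>

lemma chart_inverse:
  assumes "is_chart c"
  shows "p \<in> dom_of c \<Longrightarrow> point_at c (coord c p) = p"
    and "x \<in> coord c ` dom_of c \<Longrightarrow> coord c (point_at c x) = x"
    and "x \<in> coord c ` dom_of c \<Longrightarrow> point_at c x \<in> dom_of c"
  using assms unfolding is_chart_def homeomorphism_def by auto

lemma open_coord_image:
  assumes c: "is_chart c" and V: "open V" "V \<subseteq> dom_of c"
  shows "open (coord c ` V)"
proof -
  have "openin (top_of_set (coord c ` dom_of c)) (coord c ` V)"
    using c V by (intro homeomorphism_imp_open_map[of "dom_of c" _ _ "point_at c"])
      (auto simp: is_chart_def open_openin_trans)
  then show ?thesis using c by (auto simp: is_chart_def openin_open_eq)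
qed

lemma holo_has_derivative:
  assumes "is_chart c" "holo c f" "p \<in> dom_of c"
  shows "((\<lambda>x. f (point_at c x)) has_derivative (\<lambda>h. \<Sum>i\<in>UNIV. pd c i f p * h $ i)) (at (coord c p))"
  using hol_on_has_derivative[of "\<lambda>x. f (point_at c x)" "coord c ` dom_of c" "coord c p"] assms
  by (simp add: holo_def pd_partial)

lemma pd_eq:
  assumes "((\<lambda>x. f (point_at c x)) has_derivative (\<lambda>h. \<Sum>i\<in>UNIV. a $ i * h $ i)) (at (coord c p))"
  shows "pd c i f p = a $ i"
  unfolding pd_partial using assms by (rule partial_eq)

lemma holoI:
  assumes "is_chart c"
    and "\<And>p. p \<in> dom_of c \<Longrightarrow> ((\<lambda>x. f (point_at c x)) has_derivative (\<lambda>h. \<Sum>i\<in>UNIV. a p $ i * h $ i)) (at (coord c p))"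
  shows "holo c f"
  unfolding holo_def hol_on_def using assms(2) by blast

lemma holo_pd:
  assumes "is_chart c" "holo c f"
  shows "holo c (pd c i f)"
proof -
  have "hol_on (partial i (\<lambda>x. f (point_at c x))) (coord c ` dom_of c)"
    using assms by (intro hol_on_partial) (auto simp: holo_def is_chart_def)
  then show ?thesis
    unfolding holo_def
    by (rule hol_on_cong[rotated 2])
       (use assms in \<open>auto simp: pd_partial chart_inverse is_chart_def\<close>)
qed

lemma holo_cong:
  assumes "is_chart c" "\<And>p. p \<in> dom_of c \<Longrightarrow> f p = g p" "holo c f"
  shows "holo c g"
  using assms(3) unfolding holo_def
  by (rule hol_on_cong[rotated 2]) (use assms in \<open>auto simp: chart_inverse is_chart_def\<close>)

lemma pd_cong:
  assumes "is_chart c" "\<And>p. p \<in> dom_of c \<Longrightarrow> f p = g p" "p \<in> dom_of c"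
  shows "pd c i f p = pd c i g p"
  unfolding pd_partial
  by (rule partial_cong[of "coord c ` dom_of c"])
     (use assms in \<open>auto simp: chart_inverse is_chart_def\<close>)

lemma holo_sum_mult:
  assumes "\<And>i. i \<in> A \<Longrightarrow> holo c (f i)"
  shows "holo c (\<lambda>p. \<Sum>i\<in>A. k i * f i p)"
  using assms unfolding holo_def by (intro hol_on_sum hol_on_cmult) auto

lemma pd_sum_mult:
  assumes "is_chart c" "\<And>i. i \<in> A \<Longrightarrow> holo c (f i)" "p \<in> dom_of c"
  shows "pd c j (\<lambda>p. \<Sum>i\<in>A. k i * f i p) p = (\<Sum>i\<in>A. k i * pd c j (f i) p)"
proof -
  have "((\<lambda>x. \<Sum>i\<in>A. k i * f i (point_at c x)) has_derivative
      (\<lambda>h. \<Sum>i\<in>A. k i * (\<Sum>j\<in>UNIV. pd c j (f i) p * h $ j))) (at (coord c p))"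
    by (intro has_derivative_sum has_derivative_mult_right holo_has_derivative assms)
  also have "(\<lambda>h. \<Sum>i\<in>A. k i * (\<Sum>j\<in>UNIV. pd c j (f i) p * h $ j)) =
      (\<lambda>h. \<Sum>j\<in>UNIV. (\<chi> j. \<Sum>i\<in>A. k i * pd c j (f i) p) $ j * h $ j)"
  proof
    fix h :: "complex^'b"
    have "(\<Sum>i\<in>A. k i * (\<Sum>j\<in>UNIV. pd c j (f i) p * h $ j)) =
        (\<Sum>i\<in>A. \<Sum>j\<in>UNIV. k i * pd c j (f i) p * h $ j)"
      by (simp add: sum_distrib_left mult.assoc)
    also have "\<dots> = (\<Sum>j\<in>UNIV. \<Sum>i\<in>A. k i * pd c j (f i) p * h $ j)"
      by (rule sum.swap)
    finally show "(\<Sum>i\<in>A. k i * (\<Sum>j\<in>UNIV. pd c j (f i) p * h $ j)) =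
        (\<Sum>j\<in>UNIV. (\<chi> j. \<Sum>i\<in>A. k i * pd c j (f i) p) $ j * h $ j)"
      by (simp add: sum_distrib_right)
  qed
  finally show ?thesis by (rule pd_eq[THEN trans]) simp
qed

lemma pd_const: "pd c i (\<lambda>p. k) p = 0"
  by (simp add: pd_def)

lemma coord_has_derivative:
  assumes "is_chart c" "p \<in> dom_of c"
  shows "((\<lambda>x. coord c (point_at c x)) has_derivative (\<lambda>h. h)) (at (coord c p))"
  by (rule has_derivative_transform_within_open[OF has_derivative_ident, of "coord c ` dom_of c"])
     (use assms in \<open>auto simp: chart_inverse is_chart_def\<close>)

lemma delta_sum:
  fixes a :: "'n::finite"
  shows "(\<Sum>j\<in>UNIV. (if a = j then 1 else 0) * f j) = (f a :: complex)"
proof -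
  have "(\<Sum>j\<in>UNIV. (if a = j then 1 else 0) * f j) = (\<Sum>j\<in>UNIV. if a = j then f j else 0)"
    by (intro sum.cong) auto
  then show ?thesis by simp
qed

lemma holo_coord: "is_chart c \<Longrightarrow> holo c (\<lambda>q. coord c q $ a)"
  using has_derivative_nth[OF coord_has_derivative, of c _ a]
  by (intro holoI[where a="\<lambda>_. \<chi> j. if a = j then 1 else 0"]) (simp_all add: delta_sum)

lemma pd_coord:
  assumes "is_chart c" "p \<in> dom_of c"
  shows "pd c i (\<lambda>q. coord c q $ a) p = (if a = i then 1 else 0)"
  using has_derivative_nth[OF coord_has_derivative[OF assms], of a]
  by (subst pd_eq[where a="\<chi> j. if a = j then 1 else 0"]) (simp_all add: delta_sum)

section \<open>Chain rule between charts\<close>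

lemma compatible_sym: "compatible c d \<Longrightarrow> compatible d c"
  by (simp add: compatible_def Int_commute)

lemma transition_has_derivative:
  assumes "is_chart c" "compatible c d" "p \<in> dom_of c \<inter> dom_of d"
  shows "((\<lambda>x. coord d (point_at c x)) has_derivative ((*v) (jac c d p))) (at (coord c p))"
proof (rule has_derivative_vec)
  fix i
  have "hol_on (\<lambda>x. coord d (point_at c x) $ i) (coord c ` (dom_of c \<inter> dom_of d))"
    using assms by (simp add: compatible_def)
  from hol_on_has_derivative[OF this, of "coord c p"] assms
  show "((\<lambda>x. coord d (point_at c x) $ i) has_derivative (\<lambda>h. (jac c d p *v h) $ i)) (at (coord c p))"
    by (simp add: jac_def matrix_vector_mult_def pd_partial)
qed

lemma has_derivative_transfer:
  assumes cd: "is_chart c" "is_chart d" "compatible c d" and p: "p \<in> dom_of c \<inter> dom_of d"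
    and f: "((\<lambda>x. f (point_at c x)) has_derivative f') (at (coord c p))"
  shows "((\<lambda>x. f (point_at d x)) has_derivative (\<lambda>h. f' (jac d c p *v h))) (at (coord d p))"
proof -
  have "((\<lambda>x. coord c (point_at d x)) has_derivative (*v) (jac d c p)) (at (coord d p))"
    using p by (intro transition_has_derivative[OF cd(2) compatible_sym[OF cd(3)]]) auto
  moreover have "((\<lambda>x. f (point_at c x)) has_derivative f') (at (coord c (point_at d (coord d p))))"
    using f p chart_inverse(1)[OF cd(2), of p] by simp
  ultimately have "((\<lambda>x. f (point_at c (coord c (point_at d x)))) has_derivative (\<lambda>h. f' (jac d c p *v h))) (at (coord d p))"
    by (rule has_derivative_compose)
  then show ?thesis
  proof (rule has_derivative_transform_within_open)
    show "open (coord d ` (dom_of c \<inter> dom_of d))"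
      using cd(1,2) by (intro open_coord_image[OF cd(2)]) (auto simp: is_chart_def)
    show "coord d p \<in> coord d ` (dom_of c \<inter> dom_of d)" using p by blast
    fix x assume "x \<in> coord d ` (dom_of c \<inter> dom_of d)"
    then obtain q where q: "q \<in> dom_of c" "q \<in> dom_of d" "x = coord d q" by blast
    show "f (point_at c (coord c (point_at d x))) = f (point_at d x)"
      unfolding q(3) chart_inverse(1)[OF cd(2) q(2)] chart_inverse(1)[OF cd(1) q(1)] ..
  qed
qed

lemma sum_matrix_vector:
  "(\<Sum>i\<in>UNIV. a $ i * (J *v h) $ i) = (\<Sum>j\<in>UNIV. (\<chi> j. \<Sum>i\<in>UNIV. J $ i $ j * a $ i) $ j * (h::complex^'n) $ j)"
proof -
  have "(\<Sum>i\<in>UNIV. a $ i * (J *v h) $ i) = (\<Sum>i\<in>UNIV. \<Sum>j\<in>UNIV. J $ i $ j * a $ i * h $ j)"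
    by (simp add: matrix_vector_mult_def sum_distrib_left algebra_simps)
  also have "\<dots> = (\<Sum>j\<in>UNIV. \<Sum>i\<in>UNIV. J $ i $ j * a $ i * h $ j)"
    by (rule sum.swap)
  finally show ?thesis by (simp add: sum_distrib_right)
qed

lemma holo_transfer:
  assumes cd: "is_chart c" "is_chart d" "compatible c d" "dom_of d \<subseteq> dom_of c" and f: "holo c f"
  shows "holo d f" and "p \<in> dom_of d \<Longrightarrow> pd d j f p = (\<Sum>i\<in>UNIV. jac d c p $ i $ j * pd c i f p)"
proof -
  have *: "((\<lambda>x. f (point_at d x)) has_derivative
      (\<lambda>h. \<Sum>j\<in>UNIV. (\<chi> j. \<Sum>i\<in>UNIV. jac d c p $ i $ j * pd c i f p) $ j * h $ j)) (at (coord d p))"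
    if "p \<in> dom_of d" for p
  proof -
    have "((\<lambda>x. f (point_at d x)) has_derivative
        (\<lambda>h. \<Sum>i\<in>UNIV. (\<chi> i. pd c i f p) $ i * (jac d c p *v h) $ i)) (at (coord d p))"
      using has_derivative_transfer[OF cd(1-3) _ holo_has_derivative[OF cd(1) f]] that cd(4) by auto
    then show ?thesis unfolding sum_matrix_vector by simp
  qed
  show "holo d f" by (rule holoI[OF cd(2) *])
  show "pd d j f p = (\<Sum>i\<in>UNIV. jac d c p $ i $ j * pd c i f p)" if "p \<in> dom_of d"
    using pd_eq[OF *[OF that]] by simp
qed

text \<open>The identity in the coordinates of \<open>c\<close>, differentiated once directly and
  once through \<open>d\<close>, has only one derivative.\<close>

lemma jac_inverse:
  assumes "is_chart c" "is_chart d" "compatible c d" "p \<in> dom_of c \<inter> dom_of d"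
  shows "jac d c p ** jac c d p = mat 1"
proof -
  have "((\<lambda>x. coord c (point_at c x)) has_derivative (\<lambda>h. jac d c p *v (jac c d p *v h))) (at (coord c p))"
    using assms(4)
    by (intro has_derivative_transfer[OF assms(2,1) compatible_sym[OF assms(3)]]
      transition_has_derivative[OF assms(2) compatible_sym[OF assms(3)]]) auto
  moreover have "((\<lambda>x. coord c (point_at c x)) has_derivative (\<lambda>h. h)) (at (coord c p))"
    using assms by (intro coord_has_derivative) auto
  ultimately have "(\<lambda>h. jac d c p *v (jac c d p *v h)) = (\<lambda>h. h)"
    by (rule has_derivative_unique)
  then have "(jac d c p ** jac c d p) *v h = mat 1 *v h" for h
    by (simp add: matrix_vector_mul_assoc fun_eq_iff)
  then show ?thesis by (simp add: matrix_eq)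
qed

text \<open>Maximality of an atlas asks for compatibility with every chart. When one chart
  \<open>c\<close> covers the domain of \<open>c'\<close>, the chain rule through \<open>c\<close>
  reduces this to compatibility with \<open>c\<close> alone.\<close>

lemma compatible_trans:
  assumes "is_chart c" "is_chart c'" "is_chart d" "dom_of c' \<subseteq> dom_of c" "compatible c c'" "compatible c d"
  shows "compatible c' d"
  unfolding compatible_def hol_on_def
proof (intro conjI allI ballI)
  fix i x assume "x \<in> coord c' ` (dom_of c' \<inter> dom_of d)"
  then obtain p where p: "p \<in> dom_of c'" "p \<in> dom_of d" "p \<in> dom_of c" and x: "x = coord c' p"
    using assms(4) by auto
  have "((\<lambda>x. coord d (point_at c' x) $ i) has_derivative
      (\<lambda>h. (jac c d p *v (jac c' c p *v h)) $ i)) (at x)"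
    unfolding x
    using assms p by (intro has_derivative_nth has_derivative_transfer[of c c'] transition_has_derivative) auto
  then show "\<exists>a::complex^'b. ((\<lambda>x. coord d (point_at c' x) $ i) has_derivative (\<lambda>h. \<Sum>i\<in>UNIV. a $ i * h $ i)) (at x)"
    by (intro exI[of _ "(jac c d p ** jac c' c p) $ i"]) (simp add: matrix_vector_mul_assoc matrix_vector_mult_def[of "_ ** _"])
next
  fix i x assume "x \<in> coord d ` (dom_of c' \<inter> dom_of d)"
  then obtain p where p: "p \<in> dom_of c'" "p \<in> dom_of d" "p \<in> dom_of c" and x: "x = coord d p"
    using assms(4) by auto
  have "((\<lambda>x. coord c' (point_at d x) $ i) has_derivative
      (\<lambda>h. (jac c c' p *v (jac d c p *v h)) $ i)) (at x)"
    unfolding x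
    using assms p by (intro has_derivative_nth has_derivative_transfer[of c d] transition_has_derivative) auto
  then show "\<exists>a::complex^'b. ((\<lambda>x. coord c' (point_at d x) $ i) has_derivative (\<lambda>h. \<Sum>i\<in>UNIV. a $ i * h $ i)) (at x)"
    by (intro exI[of _ "(jac c c' p ** jac d c p) $ i"]) (simp add: matrix_vector_mul_assoc matrix_vector_mult_def[of "_ ** _"])
qed

text \<open>Invariance of domain makes the image open and the inverse continuous. The inverse
  function theorem then differentiates the inverse; its derivative is the inverse of a complex
  matrix, so the inverse is again holomorphic.\<close>

lemma new_chart:
  fixes f :: "'m::topological_space \<Rightarrow> complex^'n"
  assumes c: "is_chart c" and f: "\<And>i. holo c (\<lambda>p. f p $ i)" and inj: "inj_on f (dom_of c)"
    and J: "\<And>p. p \<in> dom_of c \<Longrightarrow> invertible (jac c (dom_of c, f) p)"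
  shows "is_chart (dom_of c, f)" "compatible c (dom_of c, f)"
proof -
  define c' where "c' = (dom_of c, f)"
  have [simp]: "fst c' = dom_of c" "snd c' = f" by (auto simp: c'_def)
  define U where "U = coord c ` dom_of c"
  define \<phi> where "\<phi> x = f (point_at c x)" for x
  have U: "open U" using c by (simp add: U_def is_chart_def)
  have hol: "hol_on (\<lambda>x. \<phi> x $ i) U" for i
    using f[of i] by (simp add: holo_def \<phi>_def U_def)
  have der: "(\<phi> has_derivative (*v) (jac c c' p)) (at (coord c p))" if "p \<in> dom_of c" for p
    unfolding \<phi>_def
    using holo_has_derivative[OF c f that]
    by (intro has_derivative_vec) (simp add: jac_def matrix_vector_mult_def)
  have cont: "continuous_on U \<phi>"
    by (intro continuous_at_imp_continuous_on) (auto simp: U_def intro: has_derivative_continuous[OF der])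
  have inj': "inj_on \<phi> U"
    using inj c by (auto simp: inj_on_def \<phi>_def U_def chart_inverse)
  have im: "\<phi> ` U = f ` dom_of c"
    using c by (auto simp: \<phi>_def U_def chart_inverse image_iff)
  have op: "open (f ` dom_of c)"
    using invariance_of_domain[OF cont U inj'] im by simp
  have pt: "point_at c' (f p) = p" if "p \<in> dom_of c" for p
    using inj that by (simp add: point_at_def)
  define \<psi> where "\<psi> y = coord c (point_at c' y)" for y
  have \<psi>: "\<psi> (\<phi> x) = x" if "x \<in> U" for x
    using that c by (auto simp: \<psi>_def \<phi>_def U_def pt chart_inverse)
  have cont_\<psi>: "continuous_on (f ` dom_of c) \<psi>"
    using continuous_on_inverse_open[OF U cont _ \<psi>] im by simp
  have "continuous_on (dom_of c) (\<lambda>p. \<phi> (coord c p))"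
    using c by (intro continuous_on_compose2[OF cont]) (auto simp: U_def is_chart_def homeomorphism_def)
  then have cont_f: "continuous_on (dom_of c) f"
    by (rule continuous_on_eq) (simp add: \<phi>_def chart_inverse c)
  have "continuous_on U (point_at c)"
    using c by (auto simp: U_def is_chart_def homeomorphism_def)
  then have "continuous_on (f ` dom_of c) (\<lambda>y. point_at c (\<psi> y))"
    by (rule continuous_on_compose2[OF _ cont_\<psi>]) (auto simp: \<psi>_def U_def pt)
  then have cont_pt: "continuous_on (f ` dom_of c) (point_at c')"
    by (rule continuous_on_eq) (auto simp: \<psi>_def pt chart_inverse c)
  show "is_chart (dom_of c, f)"
    unfolding c'_def[symmetric]
    using c by (auto simp: is_chart_def op pt cont_f cont_pt intro!: homeomorphismI)
  have \<psi>_der: "(\<psi> has_derivative (*v) (matrix_inv (jac c c' p))) (at (f p))" if p: "p \<in> dom_of c" for p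
  proof -
    have "(\<psi> has_derivative (*v) (matrix_inv (jac c c' p))) (at (\<phi> (coord c p)))"
      using p J[OF p]
      by (intro has_derivative_inverse_strong[OF U _ cont \<psi> der])
         (auto simp: U_def fun_eq_iff c'_def[symmetric] matrix_inv_cancel)
    then show ?thesis using p c by (simp add: \<phi>_def chart_inverse)
  qed
  show "compatible c (dom_of c, f)"
    unfolding c'_def[symmetric] compatible_def
  proof (intro conjI allI)
    fix i
    show "hol_on (\<lambda>x. coord c' (point_at c x) $ i) (coord c ` (dom_of c \<inter> dom_of c'))"
      using hol[of i] by (simp add: \<phi>_def U_def)
    show "hol_on (\<lambda>x. coord c (point_at c' x) $ i) (coord c' ` (dom_of c \<inter> dom_of c'))"
      unfolding hol_on_def
    proof
      fix y assume "y \<in> coord c' ` (dom_of c \<inter> dom_of c')"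
      then obtain p where p: "p \<in> dom_of c" "y = f p" by auto
      have "((\<lambda>y. \<psi> y $ i) has_derivative (\<lambda>h. (matrix_inv (jac c c' p) *v h) $ i)) (at y)"
        unfolding p(2) by (rule has_derivative_nth[OF \<psi>_der[OF p(1)]])
      then show "\<exists>a::complex^'n. ((\<lambda>y. coord c (point_at c' y) $ i) has_derivative
          (\<lambda>h. \<Sum>i\<in>UNIV. a $ i * h $ i)) (at y)"
        unfolding \<psi>_def matrix_vector_mult_def by auto
    qed
  qed
qed

section \<open>Two-point functions and monodromy exponents\<close>

text \<open>The hypothesis says, degree by degree, that the double series vanishes when its first
  variable is set to minus the second, which is the condition for divisibility by their sum.\<close>

lemma ex_quotient_by_sum:
  fixes H :: "nat \<Rightarrow> nat \<Rightarrow> 'a::comm_ring_1"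
  assumes H: "\<And>k. (\<Sum>i\<le>k. (-1) ^ i * H i (k - i)) = 0"
  shows "\<exists>Q. (fps_X + fps_const fps_X) * Q = Abs_fps (\<lambda>i. Abs_fps (\<lambda>j. H i j))"
proof
  \<comment> \<open>Comparing coefficients gives
    \<open>q i j = H (Suc i) j - q (Suc i) (j - 1)\<close>, without the last term when
    \<open>j = 0\<close>; unrolling in \<open>j\<close> yields this sum. The equations with first
    index 0 remain, and they are exactly the hypothesis.\<close>
  define q where "q i j = (\<Sum>l\<le>j. (-1) ^ l * H (Suc (i + l)) (j - l))" for i j
  show "(fps_X + fps_const fps_X) * Abs_fps (\<lambda>i. Abs_fps (\<lambda>j. q i j)) = Abs_fps (\<lambda>i. Abs_fps (\<lambda>j. H i j))"
  proof (rule fps_ext, rule fps_ext)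
    fix n k
    have "(if n = 0 then 0 else q (n - 1) k) + (if k = 0 then 0 else q n (k - 1)) = H n k"
    proof (cases n; cases k)
      assume "n = 0" "k = 0"
      then show ?thesis using H[of 0] by simp
    next
      fix k' assume "n = 0" "k = Suc k'"
      then show ?thesis using H[of "Suc k'"]
        by (simp add: q_def sum.atMost_Suc_shift sum_negf del: sum.atMost_Suc)
    next
      fix n' assume "n = Suc n'" "k = 0"
      then show ?thesis by (simp add: q_def)
    next
      fix n' k' assume "n = Suc n'" "k = Suc k'"
      then show ?thesis
        by (simp add: q_def sum.atMost_Suc_shift sum_negf del: sum.atMost_Suc)
    qed
    then show "fps_nth (fps_nth ((fps_X + fps_const fps_X) * Abs_fps (\<lambda>i. Abs_fps (\<lambda>j. q i j))) n) k =
        fps_nth (fps_nth (Abs_fps (\<lambda>i. Abs_fps (\<lambda>j. H i j))) n) k"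
      by (cases n; cases k) (simp_all add: distrib_right)
  qed
qed

text \<open>The hypothesis is orthogonality, coefficient by coefficient. It makes the quotient
  exist; it is unique because power series over power series form a domain. In second degree 0 the
  quotient is just a shift of the numerator.\<close>

lemma two_point_first_column:
  assumes "\<And>k. (\<Sum>i\<le>k. (-1) ^ (k - i) * ip F c p (grad F c (\<theta> \<alpha> i) p) (grad F c (\<theta> \<beta> (k - i)) p)) =
      (if k = 0 then \<eta> $ \<alpha> $ \<beta> else 0)"
  shows "two_point F c \<eta> \<theta> \<alpha> m \<beta> 0 p = ip F c p (grad F c (\<theta> \<alpha> (Suc m)) p) (grad F c (\<theta> \<beta> 0) p)"
proof -
  define G where "G i j = ip F c p (grad F c (\<theta> \<alpha> i) p) (grad F c (\<theta> \<beta> j) p)" for i j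
  define H where "H i j = G i j - (if i = 0 \<and> j = 0 then \<eta> $ \<alpha> $ \<beta> else 0)" for i j
  have "(\<Sum>i\<le>k. (-1) ^ i * H i (k - i)) = 0" for k
  proof (cases k)
    case 0
    then show ?thesis using assms[of 0] by (simp add: H_def G_def)
  next
    case (Suc k')
    have "(\<Sum>i\<le>k. (-1) ^ i * H i (k - i)) = (\<Sum>i\<le>k. (-1) ^ i * G i (k - i))"
      using Suc by (intro sum.cong) (auto simp: H_def)
    \<comment> \<open>Orthogonality changes the sign of the second variable, divisibility that of
      the first; in total degree \<open>k\<close> the two differ by the sign
      \<open>(-1) ^ k\<close>.\<close>
    also have "\<dots> = (-1) ^ k * (\<Sum>i\<le>k. (-1) ^ (k - i) * G i (k - i))"
      unfolding sum_distrib_left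
    proof (intro sum.cong refl)
      fix i assume "i \<in> {..k}"
      then obtain j where "k = i + j" by (auto simp: le_iff_add)
      then show "(-1) ^ i * G i (k - i) = (-1) ^ k * ((-1) ^ (k - i) * G i (k - i))"
        by (auto simp: minus_one_power_iff)
    qed
    finally show ?thesis using assms[of k] Suc by (simp add: G_def)
  qed
  then obtain Q where Q: "(fps_X + fps_const fps_X) * Q = Abs_fps (\<lambda>i. Abs_fps (\<lambda>j. H i j))"
    using ex_quotient_by_sum[of H] by blast
  have rhs: "Abs_fps (\<lambda>i. Abs_fps (\<lambda>j. G i j)) - fps_const (fps_const (\<eta> $ \<alpha> $ \<beta>)) =
      Abs_fps (\<lambda>i. Abs_fps (\<lambda>j. H i j))"
    by (rule fps_ext, rule fps_ext) (simp add: H_def)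
  have nz: "(fps_X + fps_const fps_X :: complex fps fps) \<noteq> 0"
  proof
    assume "(fps_X + fps_const fps_X :: complex fps fps) = 0"
    then have "fps_nth (fps_X + fps_const fps_X :: complex fps fps) 1 = 0" by simp
    then show False by simp
  qed
  have "(THE Q :: complex fps fps. (fps_X + fps_const fps_X) * Q =
      Abs_fps (\<lambda>i. Abs_fps (\<lambda>j. G i j)) - fps_const (fps_const (\<eta> $ \<alpha> $ \<beta>))) = Q"
    unfolding rhs
  proof (rule the_equality)
    show "(fps_X + fps_const fps_X) * Q = Abs_fps (\<lambda>i. Abs_fps (\<lambda>j. H i j))" by (rule Q)
    fix Q' assume "(fps_X + fps_const fps_X) * Q' = Abs_fps (\<lambda>i. Abs_fps (\<lambda>j. H i j))"
    then have "(fps_X + fps_const fps_X) * Q' = (fps_X + fps_const fps_X) * Q" using Q by simp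
    then show "Q' = Q" using nz by (simp only: mult_cancel_left) simp
  qed
  \<comment> \<open>In second degree 0 the summand \<open>fps_const fps_X\<close> contributes
    nothing, while \<open>fps_X\<close> shifts the first index by one. As \<open>Suc m\<close> is
    positive, the constant \<eta> has no effect on this coefficient of \<open>H\<close>.\<close>
  moreover have "fps_nth (fps_nth Q m) 0 = H (Suc m) 0"
    using arg_cong[OF Q, of "\<lambda>P. fps_nth (fps_nth P (Suc m)) 0"] by (simp add: distrib_right)
  ultimately show ?thesis
    unfolding two_point_def by (simp add: G_def H_def)
qed

section \<open>Powers of z with diagonal exponent, and the diagonal of R\<close>

lemma diag_matrix_mult_left: "(diag_matrix d ** A) $ i $ j = d i * A $ i $ j"
proof -
  have "(diag_matrix d ** A) $ i $ j = (\<Sum>k\<in>UNIV. diag_matrix d $ i $ k * A $ k $ j)"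
    by (simp add: matrix_matrix_mult_def)
  also have "\<dots> = (\<Sum>k\<in>UNIV. if k = i then d i * A $ i $ j else 0)"
    by (rule sum.cong) (auto simp: diag_matrix_def)
  finally show ?thesis by simp
qed

lemma diag_matrix_mult_right: "(A ** diag_matrix d) $ i $ j = A $ i $ j * d j"
proof -
  have "(A ** diag_matrix d) $ i $ j = (\<Sum>k\<in>UNIV. A $ i $ k * diag_matrix d $ k $ j)"
    by (simp add: matrix_matrix_mult_def)
  also have "\<dots> = (\<Sum>k\<in>UNIV. if k = j then A $ i $ j * d j else 0)"
    by (rule sum.cong) (auto simp: diag_matrix_def)
  finally show ?thesis by simp
qed

lemma zpow_diag: "zpow l (diag_matrix d) = diag_matrix (\<lambda>i. exp (l * d i))"
proof -
  have "((**) (mscale l (diag_matrix d)) ^^ k) (mat 1) = diag_matrix (\<lambda>i. (l * d i) ^ k)" for k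
  proof (induction k)
    case 0
    show ?case by (simp add: vec_eq_iff mat_def diag_matrix_def)
  next
    case (Suc k)
    have "mscale l (diag_matrix d) = diag_matrix (\<lambda>i. l * d i)"
      by (simp add: vec_eq_iff mscale_def diag_matrix_def)
    moreover have "diag_matrix (\<lambda>i. l * d i) ** diag_matrix (\<lambda>i. (l * d i) ^ k) = diag_matrix (\<lambda>i. (l * d i) ^ Suc k)"
      by (simp add: vec_eq_iff diag_matrix_mult_left) (simp add: diag_matrix_def)
    ultimately show ?case using Suc by simp
  qed
  then show ?thesis
    by (auto simp: zpow_def mexp_def vec_eq_iff diag_matrix_def exp_def scaleR_conv_of_real divide_inverse mult.commute)
qed

lemma zpow_neg_diag: "zpow l (- diag_matrix d) = diag_matrix (\<lambda>i. exp (- (l * d i)))"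
proof -
  have "- diag_matrix d = diag_matrix (\<lambda>i. - d i)"
    by (simp add: vec_eq_iff diag_matrix_def)
  then show ?thesis by (simp add: zpow_diag)
qed

text \<open>Conjugation by a diagonal matrix leaves diagonal entries unchanged. The grading
  condition therefore equates a constant with a polynomial in z whose linear coefficient is the
  entry in question.\<close>

lemma monodromy_exponents_diagonal:
  assumes "monodromy_exponents \<eta> \<mu> R Rs"
  shows "Rs 1 $ i $ i = 0"
proof -
  let ?S = "{s. Rs s \<noteq> 0}"
  have S: "finite ?S" using assms unfolding monodromy_exponents_def by (elim conjE)
  define P where "P = (\<Sum>s\<in>?S. monom (Rs s $ i $ i) s) - [:R $ i $ i:]"
  have "poly P z = 0" if nz: "z \<noteq> 0" for z
  proof -
    obtain l where l: "exp l = z" using exp_Ln[OF nz] by blast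
    have "(zpow l (diag_matrix \<mu>) ** R ** zpow l (- diag_matrix \<mu>)) $ i $ i = R $ i $ i"
      by (simp add: zpow_diag zpow_neg_diag diag_matrix_mult_left diag_matrix_mult_right)
         (simp add: exp_minus mult.assoc mult.left_commute)
    moreover have "zpow l (diag_matrix \<mu>) ** R ** zpow l (- diag_matrix \<mu>) = (\<Sum>s\<in>?S. mscale (exp l ^ s) (Rs s))"
      using assms unfolding monodromy_exponents_def by (elim conjE allE[of _ l])
    ultimately have "R $ i $ i = (\<Sum>s\<in>?S. mscale (exp l ^ s) (Rs s)) $ i $ i" by (simp only:)
    then have "R $ i $ i = (\<Sum>s\<in>?S. z ^ s * Rs s $ i $ i)"
      by (simp only: sum_component mscale_def l vec_lambda_beta)
    then show ?thesis unfolding P_def by (simp only: poly_diff poly_sum poly_monom mult.commute[of "z ^ _"]) simp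
  qed
  \<comment> \<open>The exponential omits the value 0, so \<open>P\<close> is known to vanish only
    away from 0; multiplying it by the variable gives a polynomial that vanishes everywhere.\<close>
  then have "\<forall>z. poly (pCons 0 P) z = 0" by (simp only: poly_pCons) force
  then have "P = 0" by (simp only: poly_all_0_iff_0 pCons_eq_0_iff)
  then have "coeff P 1 = 0" by simp
  moreover have "coeff P 1 = (\<Sum>s\<in>?S. if s = 1 then Rs s $ i $ i else 0)"
    by (simp add: P_def coeff_sum)
  ultimately show ?thesis using S by (cases "Rs 1 = 0") simp_all
qed

section \<open>Frobenius manifolds in flat coordinates\<close>

lemma matrix_vector_axis: "(A *v axis j 1) $ i = (A $ i $ j :: complex)"
  by (simp add: matrix_vector_mult_def sum_mult_axis)

lemma sum_axis_mult: "(\<Sum>j\<in>UNIV. axis i x $ j * f j) = (x::complex) * f i"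
  using sum_mult_axis[of f i x] by (simp add: mult.commute)

lemma vmul_component: "vmul F c p x y $ k = (\<Sum>i\<in>UNIV. x $ i * (mult_matrix F c p i *v y) $ k)"
  by (simp add: vmul_def matrix_vector_mult_def mult_matrix_def sum_distrib_left algebra_simps)

lemma vmul_axis: "vmul F c p (axis i 1) y = mult_matrix F c p i *v y"
  by (simp add: vec_eq_iff vmul_component sum_axis_mult)

lemma vmul_axis_axis: "vmul F c p (axis i 1) (axis j 1) $ k = mul F c p k i j"
  by (simp add: vmul_axis matrix_vector_axis mult_matrix_def)

lemma ip_metric: "ip F c p x y = (\<Sum>i\<in>UNIV. x $ i * (met F c p *v y) $ i)"
  by (simp add: ip_def matrix_vector_mult_def sum_distrib_left algebra_simps)

lemma ip_axis: "ip F c p (axis i 1) y = (met F c p *v y) $ i"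
  by (simp add: ip_metric sum_axis_mult)

text \<open>A point of the domain is required because symmetry and nondegeneracy of the constant
  matrix \<eta> are read off from the metric there.\<close>

locale flat_chart =
  fixes F :: "('m::{t2_space, second_countable_topology}, 'n::finite) frobenius"
    and D :: complex and c :: "('m, 'n) chart" and \<iota> :: 'n
    and \<eta> :: "complex^'n^'n" and \<mu> r :: "'n \<Rightarrow> complex"
  assumes frob: "frobenius_manifold F D"
    and flat: "flat_coordinates F D c \<iota> \<eta> \<mu> r"
    and nonempty: "dom_of c \<noteq> {}"
begin

lemma chart_mem: "c \<in> charts F"
  using flat by (simp add: flat_coordinates_def)

lemma is_chart_if: "d \<in> charts F \<Longrightarrow> is_chart d"
  using frob by (simp add: frobenius_manifold_def complex_manifold_def)

lemma chart: "is_chart c"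
  using is_chart_if[OF chart_mem] .

lemma compatible_if: "d \<in> charts F \<Longrightarrow> e \<in> charts F \<Longrightarrow> compatible d e"
  using frob by (simp add: frobenius_manifold_def complex_manifold_def)

text \<open>Maximality of the atlas, reduced to a single compatibility check. It admits both the
  transformed chart and restrictions of \<open>c\<close> to smaller domains.\<close>

lemma chart_memI:
  assumes "is_chart d" "compatible c d" "dom_of d \<subseteq> dom_of c"
  shows "d \<in> charts F"
proof -
  have cm: "complex_manifold (points F) (charts F)"
    using frob by (simp add: frobenius_manifold_def)
  have "\<forall>e\<in>charts F. compatible d e"
    using compatible_trans[OF chart assms(1) _ assms(3,2)] is_chart_if compatible_if[OF chart_mem] by blast
  moreover have "dom_of d \<subseteq> points F"
    using cm assms(3) chart_mem unfolding complex_manifold_def by blast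
  ultimately show ?thesis
    using cm assms(1) unfolding complex_manifold_def by (elim conjE allE[of _ d]) blast
qed

lemma tensorial:
  assumes "d \<in> charts F" "p \<in> dom_of c" "p \<in> dom_of d"
  shows "unity F d p = jac c d p *v unity F c p"
    and "euler F d p = jac c d p *v euler F c p"
    and "vmul F d p (jac c d p *v x) (jac c d p *v y) = jac c d p *v vmul F c p x y"
    and "ip F d p (jac c d p *v x) (jac c d p *v y) = ip F c p x y"
proof -
  have "tensorial F" using frob by (simp add: frobenius_manifold_def)
  then have *: "\<forall>p\<in>dom_of c \<inter> dom_of d.
     unity F d p = jac c d p *v unity F c p \<and>
     euler F d p = jac c d p *v euler F c p \<and>
     (\<forall>x y. vmul F d p (jac c d p *v x) (jac c d p *v y) = jac c d p *v vmul F c p x y) \<and>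
     (\<forall>x y. ip F d p (jac c d p *v x) (jac c d p *v y) = ip F c p x y)"
    unfolding tensorial_def using chart_mem assms(1) by blast
  show "unity F d p = jac c d p *v unity F c p"
    and "euler F d p = jac c d p *v euler F c p"
    and "vmul F d p (jac c d p *v x) (jac c d p *v y) = jac c d p *v vmul F c p x y"
    and "ip F d p (jac c d p *v x) (jac c d p *v y) = ip F c p x y"
    using * assms(2,3) by blast+
qed

lemma flat_components:
  assumes "p \<in> dom_of c"
  shows "met F c p = \<eta>" "unity F c p = axis \<iota> 1"
    "euler F c p $ \<beta> = (1 - D / 2 - \<mu> \<beta>) * coord c p $ \<beta> + r \<beta>"
  using flat assms by (auto simp: flat_coordinates_def)

lemma algebra:
  assumes "p \<in> dom_of c"
  shows "vmul F c p x y = vmul F c p y x"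
    and "vmul F c p (vmul F c p x y) z = vmul F c p x (vmul F c p y z)"
    and "vmul F c p (axis \<iota> 1) x = x"
    and "ip F c p x y = ip F c p y x"
    and "(\<And>y. ip F c p x y = 0) \<Longrightarrow> x = 0"
proof -
  have *: "frobenius_algebra_at F c p"
    using frob chart_mem assms unfolding frobenius_manifold_def by blast
  show "vmul F c p x y = vmul F c p y x"
    and "vmul F c p (vmul F c p x y) z = vmul F c p x (vmul F c p y z)"
    and "ip F c p x y = ip F c p y x"
    and "(\<And>y. ip F c p x y = 0) \<Longrightarrow> x = 0"
    using * unfolding frobenius_algebra_at_def by blast+
  show "vmul F c p (axis \<iota> 1) x = x"
    using * flat_components(2)[OF assms] unfolding frobenius_algebra_at_def by metis
qed

lemma vmul_left_commute:
  assumes "p \<in> dom_of c"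
  shows "vmul F c p x (vmul F c p y z) = vmul F c p y (vmul F c p x z)"
  by (simp add: algebra(2)[OF assms, symmetric] algebra(1)[OF assms, of x y])

lemma holo_mul: "holo c (\<lambda>p. mul F c p k i j)"
  using frob chart_mem unfolding frobenius_manifold_def holomorphic_components_def by blast

lemma mul_commute: "p \<in> dom_of c \<Longrightarrow> mul F c p k i j = mul F c p k j i"
  using algebra(1)[of p "axis i 1" "axis j 1"] by (simp flip: vmul_axis_axis)

lemma eta_symmetric: "\<eta> $ i $ j = \<eta> $ j $ i"
proof -
  obtain p where p: "p \<in> dom_of c" using nonempty by blast
  show ?thesis
    using algebra(4)[OF p, of "axis i 1" "axis j 1"]
    by (simp add: ip_axis matrix_vector_axis flat_components[OF p])
qed

lemma eta_invertible: "invertible \<eta>"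
proof -
  obtain p where p: "p \<in> dom_of c" using nonempty by blast
  have "x = 0" if x: "\<eta> *v x = 0" for x
  proof (rule algebra(5)[OF p])
    fix y
    have "ip F c p x y = ip F c p y x" by (rule algebra(4)[OF p])
    then show "ip F c p x y = 0"
      by (simp add: ip_metric[of _ _ _ y x] flat_components[OF p] x)
  qed
  then show ?thesis
    by (simp add: invertible_left_inverse matrix_left_invertible_ker)
qed

lemma grad_flat: "p \<in> dom_of c \<Longrightarrow> grad F c f p = matrix_inv \<eta> *v (\<chi> i. pd c i f p)"
  by (simp add: grad_def flat_components)

lemma ip_grad_axis:
  assumes "p \<in> dom_of c"
  shows "ip F c p (grad F c f p) (axis \<kappa> 1) = pd c \<kappa> f p"
proof -
  have "ip F c p (grad F c f p) (axis \<kappa> 1) = ip F c p (axis \<kappa> 1) (grad F c f p)"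
    by (rule algebra(4)[OF assms])
  then show ?thesis
    by (simp add: ip_axis grad_flat flat_components assms matrix_inv_cancel eta_invertible)
qed

text \<open>Apply the Euler axiom for the metric to two coordinate fields. The inner product is
  constant, so only the two bracket terms survive, and they contribute
  \<open>2 - D - \<mu> \<alpha> - \<mu> \<beta>\<close> times the metric entry against
  \<open>2 - D\<close> on the right.\<close>

lemma mu_duality: "(\<mu> \<alpha> + \<mu> \<beta>) * \<eta> $ \<alpha> $ \<beta> = 0"
proof -
  obtain p where p: "p \<in> dom_of c" using nonempty by blast
  let ?X = "\<lambda>q. axis \<alpha> 1 :: complex^'n" and ?Y = "\<lambda>q. axis \<beta> 1 :: complex^'n"
  \<comment> \<open>The coordinate field has constant components, so the bracket is minus the
    derivative of the Euler components, which are affine with diagonal linear part.\<close>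
  have lie: "lie c (euler F c) (\<lambda>q. axis i 1) p = axis i (- (1 - D / 2 - \<mu> i))" for i
  proof (rule vec_eq_iff[THEN iffD2], rule allI)
    fix k
    have "pd c i (\<lambda>q. euler F c q $ k) p = pd c i (\<lambda>q. (1 - D / 2 - \<mu> k) * coord c q $ k + r k) p"
      by (rule pd_cong[OF chart _ p]) (rule flat_components(3))
    also have "\<dots> = (1 - D / 2 - \<mu> k) * (if k = i then 1 else 0)"
    proof -
      have "((\<lambda>x. (1 - D / 2 - \<mu> k) * coord c (point_at c x) $ k + r k) has_derivative
          (\<lambda>h. (1 - D / 2 - \<mu> k) * h $ k)) (at (coord c p))"
        using has_derivative_nth[OF coord_has_derivative[OF chart p], of k]
        by (auto intro!: derivative_eq_intros)
      then have "((\<lambda>x. (1 - D / 2 - \<mu> k) * coord c (point_at c x) $ k + r k) has_derivative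
          (\<lambda>h. \<Sum>j\<in>UNIV. (\<chi> j. (1 - D / 2 - \<mu> k) * (if k = j then 1 else 0)) $ j * h $ j)) (at (coord c p))"
        by (simp add: mult.assoc delta_sum flip: sum_distrib_left)
      from pd_eq[OF this, of i] show ?thesis by simp
    qed
    finally show "lie c (euler F c) (\<lambda>q. axis i 1) p $ k = axis i (- (1 - D / 2 - \<mu> i)) $ k"
      by (simp add: lie_def pd_const sum_negf sum_axis_mult) (auto simp: axis_def)
  qed
  have "(\<Sum>l\<in>UNIV. euler F c p $ l * pd c l (\<lambda>q. ip F c q (?X q) (?Y q)) p)
             - ip F c p (lie c (euler F c) ?X p) (?Y p)
             - ip F c p (?X p) (lie c (euler F c) ?Y p) = (2 - D) * ip F c p (?X p) (?Y p)"
  proof -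
    have "\<forall>X Y. (\<forall>i. holo c (\<lambda>q. X q $ i)) \<and> (\<forall>i. holo c (\<lambda>q. Y q $ i)) \<longrightarrow>
        (\<Sum>l\<in>UNIV. euler F c p $ l * pd c l (\<lambda>q. ip F c q (X q) (Y q)) p)
             - ip F c p (lie c (euler F c) X p) (Y p)
             - ip F c p (X p) (lie c (euler F c) Y p) = (2 - D) * ip F c p (X p) (Y p)"
      using frob chart_mem p unfolding frobenius_manifold_def by blast
    from this[rule_format, of ?X ?Y] show ?thesis
      unfolding holo_def by (simp add: hol_on_const)
  qed
  moreover have "pd c l (\<lambda>q. ip F c q (?X q) (?Y q)) p = 0" for l
  proof -
    have "pd c l (\<lambda>q. ip F c q (?X q) (?Y q)) p = pd c l (\<lambda>q. \<eta> $ \<alpha> $ \<beta>) p"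
      by (rule pd_cong[OF chart _ p]) (simp add: ip_axis flat_components matrix_vector_axis)
    then show ?thesis by (simp add: pd_const)
  qed
  moreover have "ip F c p (axis i s) (axis j t) = s * t * \<eta> $ i $ j" for i j s t
    by (simp add: ip_metric sum_axis_mult flat_components[OF p] matrix_vector_mult_def sum_mult_axis)
  ultimately show ?thesis
    by (simp add: lie algebra_simps)
qed

text \<open>Multiplying the intertwining relation of \<mu> and \<eta> by the inverse of \<eta> on
  both sides carries it over to raised indices.\<close>

lemma mu_duality_inverse: "matrix_inv \<eta> $ \<alpha> $ \<beta> * \<mu> \<beta> = - \<mu> \<alpha> * matrix_inv \<eta> $ \<alpha> $ \<beta>"
proof -
  let ?N = "matrix_inv \<eta>"
  note inv = matrix_inv[OF eta_invertible]
  have "diag_matrix \<mu> ** \<eta> = \<eta> ** diag_matrix (\<lambda>i. - \<mu> i)"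
    using mu_duality by (simp add: vec_eq_iff diag_matrix_mult_left diag_matrix_mult_right algebra_simps add_eq_0_iff)
  then have "?N ** (diag_matrix \<mu> ** \<eta>) ** ?N = ?N ** (\<eta> ** diag_matrix (\<lambda>i. - \<mu> i)) ** ?N"
    by simp
  also have "\<dots> = (?N ** \<eta>) ** diag_matrix (\<lambda>i. - \<mu> i) ** ?N"
    by (simp only: matrix_mul_assoc)
  also have "?N ** (diag_matrix \<mu> ** \<eta>) ** ?N = ?N ** diag_matrix \<mu> ** (\<eta> ** ?N)"
    by (simp only: matrix_mul_assoc)
  finally have "?N ** diag_matrix \<mu> = diag_matrix (\<lambda>i. - \<mu> i) ** ?N"
    by (simp add: inv)
  then have "(?N ** diag_matrix \<mu>) $ \<alpha> $ \<beta> = (diag_matrix (\<lambda>i. - \<mu> i) ** ?N) $ \<alpha> $ \<beta>"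
    by simp
  then show ?thesis
    by (simp add: diag_matrix_mult_left diag_matrix_mult_right)
qed

end

section \<open>The transformed coordinates\<close>

text \<open>The differential as a row vector: changes of coordinates act on it from the right by
  Jacobians, so successive changes become matrix products that cancel.\<close>

definition dpd :: "('m, 'n::finite) chart \<Rightarrow> ('m \<Rightarrow> complex) \<Rightarrow> 'm \<Rightarrow> complex^'n" where
  "dpd c f p = (\<chi> i. pd c i f p)"

lemma dpd_component: "dpd c f p $ i = pd c i f p"
  by (simp add: dpd_def)

lemma dpd_transfer:
  assumes "is_chart c" "is_chart d" "compatible c d" "dom_of d \<subseteq> dom_of c" "holo c f" "p \<in> dom_of d"
  shows "dpd d f p = dpd c f p v* jac d c p"
  using holo_transfer(2)[OF assms]
  by (simp add: vec_eq_iff dpd_component vector_matrix_mult_def mult.commute)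

locale calibrated_chart = flat_chart F D c \<iota> \<eta> \<mu> r
  for F :: "('m::{t2_space, second_countable_topology}, 'n::finite) frobenius"
    and D and c :: "('m, 'n) chart" and \<iota> and \<eta> and \<mu> and r +
  fixes R :: "complex^'n^'n" and Rs :: "nat \<Rightarrow> complex^'n^'n" and \<theta> :: "'n \<Rightarrow> nat \<Rightarrow> 'm \<Rightarrow> complex" and \<kappa> :: 'n
  assumes exponents: "monodromy_exponents \<eta> \<mu> R Rs"
    and cal: "calibration F c \<iota> \<eta> \<mu> Rs \<theta>"
    and unit: "\<forall>p\<in>dom_of c. invertible (mult_matrix F c p \<kappa>)"
begin

lemma holo_theta: "holo c (\<theta> \<alpha> m)"
  using cal by (simp add: calibration_def)

lemma calibrationD:
  assumes "p \<in> dom_of c"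
  shows "\<theta> \<alpha> 0 p = (\<Sum>\<rho>\<in>UNIV. \<eta> $ \<alpha> $ \<rho> * coord c p $ \<rho>)"
    and "pd c i (pd c j (\<theta> \<alpha> (Suc m))) p = (\<Sum>\<sigma>\<in>UNIV. mul F c p \<sigma> i j * pd c \<sigma> (\<theta> \<alpha> m) p)"
    and "(\<Sum>\<rho>\<in>UNIV. \<Sum>\<sigma>\<in>UNIV. fps_const (met F c p $ \<rho> $ \<sigma>) *
             grad_series F c (\<theta> \<alpha>) p \<rho> * fps_compose (grad_series F c (\<theta> \<beta>) p \<sigma>) (- fps_X)) =
          fps_const (\<eta> $ \<alpha> $ \<beta>)"
    and "(\<Sum>\<rho>\<in>UNIV. euler F c p $ \<rho> * pd c \<rho> (pd c \<beta> (\<theta> \<alpha> m)) p) =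
          (of_nat m + \<mu> \<alpha> + \<mu> \<beta>) * pd c \<beta> (\<theta> \<alpha> m) p +
          (\<Sum>\<gamma>\<in>UNIV. \<Sum>k=1..m. Rs k $ \<gamma> $ \<alpha> * pd c \<beta> (\<theta> \<gamma> (m - k)) p)"
  using cal assms unfolding calibration_def by blast+

lemma pd_theta_0:
  assumes "p \<in> dom_of c"
  shows "pd c i (\<theta> \<alpha> 0) p = \<eta> $ \<alpha> $ i"
proof -
  have "pd c i (\<theta> \<alpha> 0) p = pd c i (\<lambda>q. \<Sum>\<rho>\<in>UNIV. \<eta> $ \<alpha> $ \<rho> * coord c q $ \<rho>) p"
    by (rule pd_cong[OF chart _ assms]) (rule calibrationD(1))
  also have "\<dots> = (\<Sum>\<rho>\<in>UNIV. \<eta> $ \<alpha> $ \<rho> * pd c i (\<lambda>q. coord c q $ \<rho>) p)"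
    using chart assms by (intro pd_sum_mult holo_coord)
  finally show ?thesis
    using chart assms by (simp add: pd_coord if_distrib cong: if_cong)
qed

lemma grad_theta_0:
  assumes "p \<in> dom_of c"
  shows "grad F c (\<theta> \<kappa> 0) p = axis \<kappa> 1"
proof -
  have "(\<chi> i. pd c i (\<theta> \<kappa> 0) p) = \<eta> *v axis \<kappa> 1"
    using eta_symmetric by (simp add: vec_eq_iff matrix_vector_axis pd_theta_0 assms)
  then show ?thesis
    by (simp add: grad_flat assms matrix_inv_cancel eta_invertible)
qed

text \<open>Substituting minus the variable in the second gradient series puts the sign
  \<open>(-1) ^ (k - i)\<close> on its coefficients; the rest is exchanging finite sums to read off
  the coefficient of degree \<open>k\<close>.\<close>

lemma orthogonality:
  assumes "p \<in> dom_of c"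
  shows "(\<Sum>i\<le>k. (-1) ^ (k - i) * ip F c p (grad F c (\<theta> \<alpha> i) p) (grad F c (\<theta> \<beta> (k - i)) p)) =
      (if k = 0 then \<eta> $ \<alpha> $ \<beta> else 0)"
proof -
  let ?g = "\<lambda>\<alpha> i \<rho>. grad F c (\<theta> \<alpha> i) p $ \<rho>"
  have "(\<Sum>i\<le>k. (-1) ^ (k - i) * ip F c p (grad F c (\<theta> \<alpha> i) p) (grad F c (\<theta> \<beta> (k - i)) p)) =
      (\<Sum>i\<le>k. \<Sum>\<rho>\<in>UNIV. \<Sum>\<sigma>\<in>UNIV. met F c p $ \<rho> $ \<sigma> * ?g \<alpha> i \<rho> * ((-1) ^ (k - i) * ?g \<beta> (k - i) \<sigma>))"
    unfolding ip_def sum_distrib_left by (intro sum.cong refl) (simp only: ac_simps)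
  also have "\<dots> = (\<Sum>\<rho>\<in>UNIV. \<Sum>i\<le>k. \<Sum>\<sigma>\<in>UNIV. met F c p $ \<rho> $ \<sigma> * ?g \<alpha> i \<rho> * ((-1) ^ (k - i) * ?g \<beta> (k - i) \<sigma>))"
    by (rule sum.swap)
  also have "\<dots> = (\<Sum>\<rho>\<in>UNIV. \<Sum>\<sigma>\<in>UNIV. \<Sum>i\<le>k. met F c p $ \<rho> $ \<sigma> * ?g \<alpha> i \<rho> * ((-1) ^ (k - i) * ?g \<beta> (k - i) \<sigma>))"
    by (intro sum.cong refl sum.swap)
  also have "\<dots> = fps_nth (\<Sum>\<rho>\<in>UNIV. \<Sum>\<sigma>\<in>UNIV. fps_const (met F c p $ \<rho> $ \<sigma>) *
             grad_series F c (\<theta> \<alpha>) p \<rho> * fps_compose (grad_series F c (\<theta> \<beta>) p \<sigma>) (- fps_X)) k"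
  proof -
    have "fps_nth (fps_const a * f * g) k = (\<Sum>i\<le>k. a * fps_nth f i * fps_nth g (k - i))" for a :: complex and f g
      by (simp add: fps_mult_nth[of "fps_const a * f"] atLeast0AtMost)
    then show ?thesis by (simp add: fps_sum_nth grad_series_def fps_compose_uminus')
  qed
  also have "\<dots> = (if k = 0 then \<eta> $ \<alpha> $ \<beta> else 0)"
    by (simp add: calibrationD(3)[OF assms])
  finally show ?thesis .
qed

lemma two_point_eq:
  assumes "p \<in> dom_of c"
  shows "two_point F c \<eta> \<theta> \<alpha> m \<kappa> 0 p = pd c \<kappa> (\<theta> \<alpha> (Suc m)) p"
  using two_point_first_column[where F=F and c=c and p=p and \<theta>=\<theta> and \<alpha>=\<alpha> and \<beta>=\<kappa> and \<eta>=\<eta>,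
      OF orthogonality[OF assms]] assms
  by (simp add: grad_theta_0 ip_grad_axis)

lemma holo_two_point: "holo c (two_point F c \<eta> \<theta> \<alpha> m \<kappa> 0)"
  by (rule holo_cong[OF chart two_point_eq[symmetric] holo_pd[OF chart holo_theta]])

lemma dpd_two_point:
  assumes "p \<in> dom_of c"
  shows "dpd c (two_point F c \<eta> \<theta> \<alpha> m \<kappa> 0) p = dpd c (\<theta> \<alpha> m) p v* mult_matrix F c p \<kappa>"
proof (rule vec_eq_iff[THEN iffD2], rule allI)
  fix i
  have "dpd c (two_point F c \<eta> \<theta> \<alpha> m \<kappa> 0) p $ i = pd c i (pd c \<kappa> (\<theta> \<alpha> (Suc m))) p"
    unfolding dpd_component by (rule pd_cong[OF chart two_point_eq assms])
  also have "\<dots> = (\<Sum>\<sigma>\<in>UNIV. mul F c p \<sigma> i \<kappa> * pd c \<sigma> (\<theta> \<alpha> m) p)"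
    by (rule calibrationD(2)[OF assms])
  finally show "dpd c (two_point F c \<eta> \<theta> \<alpha> m \<kappa> 0) p $ i = (dpd c (\<theta> \<alpha> m) p v* mult_matrix F c p \<kappa>) $ i"
    by (simp add: vector_matrix_mult_def dpd_component mult_matrix_def mul_commute[OF assms, of _ i] mult.commute)
qed

abbreviation "\<phi> \<equiv> legendre_coord F c \<eta> \<theta> \<kappa>"
abbreviation "c' \<equiv> (dom_of c, \<phi>)"

lemma legendre_coord_component: "\<phi> p $ \<alpha> = (\<Sum>\<beta>\<in>UNIV. matrix_inv \<eta> $ \<alpha> $ \<beta> * two_point F c \<eta> \<theta> \<beta> 0 \<kappa> 0 p)"
  by (simp add: legendre_coord_def)

lemma holo_legendre_coord: "holo c (\<lambda>p. \<phi> p $ \<alpha>)"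
  unfolding legendre_coord_component by (rule holo_sum_mult[OF holo_two_point])

text \<open>Differentiating the lowered coordinates gives \<eta> times the multiplication matrix,
  since the differentials of the \<open>\<theta> \<beta> 0\<close> are the rows of \<eta>; raising
  the index removes that factor.\<close>

lemma pd_legendre_coord:
  assumes "p \<in> dom_of c"
  shows "pd c i (\<lambda>p. \<phi> p $ \<alpha>) p = mult_matrix F c p \<kappa> $ \<alpha> $ i"
proof -
  have "pd c i (\<lambda>p. \<phi> p $ \<alpha>) p = (\<Sum>\<beta>\<in>UNIV. matrix_inv \<eta> $ \<alpha> $ \<beta> * pd c i (two_point F c \<eta> \<theta> \<beta> 0 \<kappa> 0) p)"
    unfolding legendre_coord_component by (rule pd_sum_mult[OF chart holo_two_point assms])
  also have "\<dots> = (matrix_inv \<eta> ** (\<eta> ** mult_matrix F c p \<kappa>)) $ \<alpha> $ i"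
    unfolding matrix_matrix_mult_def[of "matrix_inv \<eta>"]
    using dpd_two_point[OF assms, of _ 0]
    by (simp add: vec_eq_iff dpd_component vector_matrix_mult_def matrix_matrix_mult_def pd_theta_0[OF assms])
  also have "\<dots> = mult_matrix F c p \<kappa> $ \<alpha> $ i"
    by (simp add: matrix_mul_assoc matrix_inv eta_invertible)
  finally show ?thesis .
qed

lemma jac_legendre: "p \<in> dom_of c \<Longrightarrow> jac c c' p = mult_matrix F c p \<kappa>"
  by (simp add: jac_def vec_eq_iff pd_legendre_coord)

end

text \<open>Injectivity is the one ingredient not implied by the invertibility of the Jacobian; with
  it the new coordinates form a chart on the same domain.\<close>

locale legendre_chart = calibrated_chart +
  assumes inj: "inj_on \<phi> (dom_of c)"
begin

lemma chart': "is_chart c'" and compatible: "compatible c c'"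
proof -
  have "invertible (jac c c' p)" if "p \<in> dom_of c" for p
    using unit that by (simp add: jac_legendre)
  then show "is_chart c'" and "compatible c c'"
    using new_chart[OF chart holo_legendre_coord inj] by auto
qed

lemma chart_mem': "c' \<in> charts F"
  using chart_memI[OF chart' compatible] by simp

abbreviation "J \<equiv> jac c c'"
abbreviation "K \<equiv> jac c' c"

lemma jac_inverses:
  assumes "p \<in> dom_of c"
  shows "K p ** J p = mat 1" "J p ** K p = mat 1"
  using jac_inverse[OF chart chart' compatible, of p] assms matrix_left_right_inverse[of "K p" "J p"] by auto

lemma jac_cancel:
  assumes "p \<in> dom_of c"
  shows "K p *v (J p *v x) = x" "J p *v (K p *v x) = x"
  by (simp_all add: matrix_vector_mul_assoc jac_inverses[OF assms])

lemma J_vmul: "p \<in> dom_of c \<Longrightarrow> J p *v x = vmul F c p (axis \<kappa> 1) x"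
  by (simp add: jac_legendre vmul_axis)

text \<open>The Jacobian \<open>J\<close> is itself multiplication by the \<kappa>-th field, so by
  associativity and commutativity it can be moved onto the second factor, where it cancels
  \<open>K\<close>. Thus only one argument has to be converted to the old chart; all later
  comparisons of multiplication matrices rest on this asymmetry.\<close>

lemma vmul':
  assumes p: "p \<in> dom_of c"
  shows "vmul F c' p u w = vmul F c p (K p *v u) w"
proof -
  have "vmul F c' p u w = vmul F c' p (J p *v (K p *v u)) (J p *v (K p *v w))"
    by (simp add: jac_cancel p)
  also have "\<dots> = J p *v vmul F c p (K p *v u) (K p *v w)"
    using p by (intro tensorial(3) chart_mem') auto
  also have "\<dots> = vmul F c p (K p *v u) (vmul F c p (axis \<kappa> 1) (K p *v w))"
    unfolding J_vmul[OF p] by (rule vmul_left_commute[OF p])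
  also have "vmul F c p (axis \<kappa> 1) (K p *v w) = w"
    by (simp add: J_vmul[OF p, symmetric] jac_cancel p)
  finally show ?thesis .
qed

lemma mul':
  assumes p: "p \<in> dom_of c"
  shows "mul F c' p k i j = (\<Sum>l\<in>UNIV. K p $ l $ i * mul F c p k l j)"
  using vmul'[OF p, of "axis i 1" "axis j 1"]
  by (simp add: vmul_axis_axis[symmetric] vmul_component[of F c p "K p *v _"] vmul_axis matrix_vector_axis)

text \<open>By \<open>vmul'\<close> only the first factor is converted, and converting the new
  components of the Euler field returns the old ones.\<close>

lemma euler_matrix':
  assumes p: "p \<in> dom_of c"
  shows "euler_matrix F c' p = euler_matrix F c p"
proof -
  have E: "euler_matrix F d p $ \<alpha> $ \<beta> = vmul F d p (euler F d p) (axis \<beta> 1) $ \<alpha>" for d \<alpha> \<beta>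
    by (simp add: euler_matrix_def vmul_component matrix_vector_axis mult_matrix_def)
  have "K p *v euler F c' p = euler F c p"
    using tensorial(2)[OF chart_mem', of p] p by (simp add: jac_cancel)
  then have "euler_matrix F c' p $ \<alpha> $ \<beta> = euler_matrix F c p $ \<alpha> $ \<beta>" for \<alpha> \<beta>
    by (simp add: E vmul'[OF p])
  then show ?thesis by (simp add: vec_eq_iff)
qed

section \<open>Metric, unity and Euler field in the new coordinates\<close>

abbreviation "S \<equiv> legendre F c \<kappa>"

lemma legendre_simps:
  "charts S = {d \<in> charts F. dom_of d \<subseteq> dom_of c}" "mul S = mul F" "unity S = unity F" "euler S = euler F"
  by (simp_all add: legendre_def)

lemma mult_matrix': "p \<in> dom_of c \<Longrightarrow>
    mult_matrix S c' p \<alpha> $ i $ j = (\<Sum>l\<in>UNIV. K p $ l $ \<alpha> * mult_matrix F c p l $ i $ j)"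
  by (simp add: mult_matrix_def legendre_simps mul')

text \<open>The twist in the new metric multiplies each coordinate field of \<open>c'\<close> by the
  \<kappa>-th field of \<open>c\<close>, which by \<open>vmul'\<close> is the matrix
  \<open>J\<close>. But \<open>J\<close> also transports vectors from \<open>c\<close> to
  \<open>c'\<close>, so the twisted metric is the old metric evaluated on the old coordinate
  fields.\<close>

lemma met':
  assumes p: "p \<in> dom_of c"
  shows "met S c' p = \<eta>"
proof (rule vec_eq_iff[THEN iffD2], rule allI, rule vec_eq_iff[THEN iffD2], rule allI)
  fix i j
  have *: "vmul F c' p (coord_vec c \<kappa> c' p) x = J p *v x" for x
    by (simp only: coord_vec_def vmul'[OF p] jac_cancel[OF p]) (rule J_vmul[OF p, symmetric])
  have "met S c' p $ i $ j = ip F c' p (J p *v axis i 1) (J p *v axis j 1)"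
    by (simp add: legendre_def *)
  also have "\<dots> = ip F c p (axis i 1) (axis j 1)"
    using p by (intro tensorial(4) chart_mem') auto
  finally show "met S c' p $ i $ j = \<eta> $ i $ j"
    by (simp add: ip_axis matrix_vector_axis flat_components p)
qed

lemma unity':
  assumes p: "p \<in> dom_of c"
  shows "unity S c' p = axis \<kappa> 1"
proof -
  have "unity S c' p = vmul F c p (axis \<kappa> 1) (axis \<iota> 1)"
    using tensorial(1)[OF chart_mem', of p] p
    by (simp add: legendre_simps flat_components J_vmul)
  also have "\<dots> = vmul F c p (axis \<iota> 1) (axis \<kappa> 1)" by (rule algebra(1)[OF p])
  also have "\<dots> = axis \<kappa> 1" by (rule algebra(3)[OF p])
  finally show ?thesis .
qed

lemma R1_diagonal: "Rs (Suc 0) $ \<kappa> $ \<kappa> = 0"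
  using monodromy_exponents_diagonal[OF exponents, of \<kappa>] by simp

lemma R1_duality: "matrix_inv \<eta> ** transpose (Rs 1) ** \<eta> = Rs 1"
proof -
  have "\<forall>s\<ge>1. matrix_inv \<eta> ** transpose (Rs s) ** \<eta> = mscale ((-1) ^ (s + 1)) (Rs s)"
    using exponents unfolding monodromy_exponents_def by (elim conjE)
  from this[rule_format, of 1] show ?thesis by (simp add: mscale_def vec_eq_iff)
qed

text \<open>The linear part comes from the homogeneity of the two-point functions of lowest order,
  the constant part from the term with \<open>Rs 1\<close> in the same relation. Raising the index
  turns \<open>\<mu> \<beta>\<close> into \<open>- \<mu> \<alpha>\<close> and, by the symmetry of
  \<open>Rs 1\<close> with respect to \<eta>, undoes its transposition.\<close>

lemma euler':
  assumes p: "p \<in> dom_of c"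
  shows "euler S c' p $ \<alpha> = (1 + \<mu> \<kappa> - \<mu> \<alpha>) * \<phi> p $ \<alpha> + Rs 1 $ \<alpha> $ \<kappa>"
proof -
  let ?N = "matrix_inv \<eta>" and ?E = "\<lambda>i. euler F c p $ i" and ?t = "\<lambda>\<beta>. two_point F c \<eta> \<theta> \<beta> 0 \<kappa> 0"
  have t: "(\<Sum>i\<in>UNIV. ?E i * pd c i (?t \<beta>) p) =
      (1 + \<mu> \<beta> + \<mu> \<kappa>) * ?t \<beta> p + (\<Sum>\<gamma>\<in>UNIV. Rs 1 $ \<gamma> $ \<beta> * \<eta> $ \<gamma> $ \<kappa>)" for \<beta>
  proof -
    have "pd c i (?t \<beta>) p = pd c i (pd c \<kappa> (\<theta> \<beta> (Suc 0))) p" for i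
      by (rule pd_cong[OF chart two_point_eq p])
    then show ?thesis
      using calibrationD(4)[OF p, of \<kappa> \<beta> "Suc 0"]
      by (simp add: two_point_eq p pd_theta_0)
  qed
  have "euler S c' p $ \<alpha> = (\<Sum>i\<in>UNIV. pd c i (\<lambda>p. \<phi> p $ \<alpha>) p * ?E i)"
    using tensorial(2)[OF chart_mem', of p] p
    by (simp add: legendre_simps jac_def matrix_vector_mult_def)
  also have "\<dots> = (\<Sum>i\<in>UNIV. \<Sum>\<beta>\<in>UNIV. ?N $ \<alpha> $ \<beta> * (?E i * pd c i (?t \<beta>) p))"
    unfolding legendre_coord_component pd_sum_mult[OF chart holo_two_point p]
    by (simp add: sum_distrib_left mult_ac)
  also have "\<dots> = (\<Sum>\<beta>\<in>UNIV. \<Sum>i\<in>UNIV. ?N $ \<alpha> $ \<beta> * (?E i * pd c i (?t \<beta>) p))"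
    by (rule sum.swap)
  also have "\<dots> = (\<Sum>\<beta>\<in>UNIV. ?N $ \<alpha> $ \<beta> * ((1 + \<mu> \<beta> + \<mu> \<kappa>) * ?t \<beta> p + (\<Sum>\<gamma>\<in>UNIV. Rs 1 $ \<gamma> $ \<beta> * \<eta> $ \<gamma> $ \<kappa>)))"
    by (simp only: sum_distrib_left[symmetric] t)
  also have "\<dots> = (\<Sum>\<beta>\<in>UNIV. (1 + \<mu> \<kappa> - \<mu> \<alpha>) * (?N $ \<alpha> $ \<beta> * ?t \<beta> p)) +
      (\<Sum>\<beta>\<in>UNIV. ?N $ \<alpha> $ \<beta> * (\<Sum>\<gamma>\<in>UNIV. Rs 1 $ \<gamma> $ \<beta> * \<eta> $ \<gamma> $ \<kappa>))"
  proof -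
    have *: "?N $ \<alpha> $ \<beta> * ((1 + \<mu> \<beta> + \<mu> \<kappa>) * x) = (1 + \<mu> \<kappa> - \<mu> \<alpha>) * (?N $ \<alpha> $ \<beta> * x)" for \<beta> x
    proof -
      have "?N $ \<alpha> $ \<beta> * ((1 + \<mu> \<beta> + \<mu> \<kappa>) * x) = ((1 + \<mu> \<kappa>) * ?N $ \<alpha> $ \<beta> + ?N $ \<alpha> $ \<beta> * \<mu> \<beta>) * x"
        by (simp add: algebra_simps)
      then show ?thesis unfolding mu_duality_inverse by (simp add: algebra_simps)
    qed
    show ?thesis by (simp only: distrib_left[of "?N $ _ $ _"] sum.distrib *)
  qed
  also have "(\<Sum>\<beta>\<in>UNIV. ?N $ \<alpha> $ \<beta> * (\<Sum>\<gamma>\<in>UNIV. Rs 1 $ \<gamma> $ \<beta> * \<eta> $ \<gamma> $ \<kappa>)) = (?N ** (transpose (Rs 1) ** \<eta>)) $ \<alpha> $ \<kappa>"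
    by (simp add: matrix_matrix_mult_def transpose_def)
  also have "\<dots> = Rs 1 $ \<alpha> $ \<kappa>"
    by (simp only: matrix_mul_assoc R1_duality)
  finally show ?thesis
    by (simp add: legendre_coord_component sum_distrib_left)
qed

text \<open>The charge \<open>- 2 * \<mu> \<kappa>\<close> is dictated by the normalisation of the
  exponent in the unity direction \<kappa>; it turns the coefficient
  \<open>1 + \<mu> \<kappa> - \<mu> \<alpha>\<close> into the standard form. The other
  normalisation, a zero constant term in that direction, is \<open>R1_diagonal\<close>.\<close>

theorem flat_coordinates_legendre:
  "flat_coordinates S (- 2 * \<mu> \<kappa>) c' \<kappa> \<eta> \<mu> (\<lambda>\<beta>. Rs 1 $ \<beta> $ \<kappa>)"
  unfolding flat_coordinates_def
  using chart_mem' by (simp add: legendre_simps(1) met' unity' euler' R1_diagonal)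

end

section \<open>Fundamental solutions and the new calibration\<close>

lemma analytic_transfer:
  assumes cd: "is_chart c" "is_chart d" "compatible c d" "dom_of d \<subseteq> dom_of c"
    and f: "analytic_on_times_plane c f"
  shows "analytic_on_times_plane d f"
  unfolding analytic_on_times_plane_def
proof (intro ballI allI)
  fix x z assume "x \<in> coord d ` dom_of d"
  then obtain p where p: "p \<in> dom_of d" "x = coord d p" "p \<in> dom_of c" using cd(4) by blast
  obtain a :: "complex^'b" and b where ab: "((\<lambda>(y, w). f (point_at c y) w) has_derivative
      (\<lambda>(h, k). (\<Sum>i\<in>UNIV. a $ i * h $ i) + b * k)) (at (coord c p, z))"
    using f p(3) unfolding analytic_on_times_plane_def by blast
  have pt: "point_at d (coord d q) = q" "point_at c (coord c q) = q" if "q \<in> dom_of d" for q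
    using that cd by (auto intro: chart_inverse(1))
  have fst: "(fst has_derivative fst) (at (x, z))"
    by (rule bounded_linear_imp_has_derivative[OF bounded_linear_fst])
  have snd: "(snd has_derivative snd) (at (x, z))"
    by (rule bounded_linear_imp_has_derivative[OF bounded_linear_snd])
  have "((\<lambda>y. coord c (point_at d y)) has_derivative (*v) (jac d c p)) (at (fst (x, z)))"
    using transition_has_derivative[OF cd(2) compatible_sym[OF cd(3)], of p] p by simp
  from has_derivative_compose[OF fst this]
  have "((\<lambda>u. coord c (point_at d (fst u))) has_derivative (\<lambda>v. jac d c p *v fst v)) (at (x, z))" .
  then have "((\<lambda>u. (coord c (point_at d (fst u)), snd u)) has_derivative
      (\<lambda>v. (jac d c p *v fst v, snd v))) (at (x, z))"
    using snd by (rule has_derivative_Pair)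
  moreover have "((\<lambda>(y, w). f (point_at c y) w) has_derivative
      (\<lambda>(h, k). (\<Sum>i\<in>UNIV. a $ i * h $ i) + b * k)) (at (coord c (point_at d (fst (x, z))), snd (x, z)))"
    using ab p by (simp add: pt)
  ultimately have "((\<lambda>u. case (coord c (point_at d (fst u)), snd u) of (y, w) \<Rightarrow> f (point_at c y) w) has_derivative
      (\<lambda>v. case (jac d c p *v fst v, snd v) of (h, k) \<Rightarrow> (\<Sum>i\<in>UNIV. a $ i * h $ i) + b * k)) (at (x, z))"
    by (rule has_derivative_compose)
  then have "((\<lambda>u. case (coord c (point_at d (fst u)), snd u) of (y, w) \<Rightarrow> f (point_at c y) w) has_derivative
      (\<lambda>(h, k). (\<Sum>j\<in>UNIV. (\<chi> j. \<Sum>i\<in>UNIV. jac d c p $ i $ j * a $ i) $ j * h $ j) + b * k)) (at (x, z))"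
    unfolding prod.case sum_matrix_vector by (simp add: case_prod_unfold)
  then have "((\<lambda>(y, w). f (point_at d y) w) has_derivative
      (\<lambda>(h, k). (\<Sum>j\<in>UNIV. (\<chi> j. \<Sum>i\<in>UNIV. jac d c p $ i $ j * a $ i) $ j * h $ j) + b * k)) (at (x, z))"
  proof (rule has_derivative_transform_within_open)
    show "open ((coord d ` dom_of d) \<times> (UNIV :: complex set))"
      using cd(2) by (intro open_Times) (auto simp: is_chart_def)
    show "(x, z) \<in> (coord d ` dom_of d) \<times> UNIV" using p by simp
    fix u :: "(complex^'b) \<times> complex" assume "u \<in> (coord d ` dom_of d) \<times> UNIV"
    then obtain q where "q \<in> dom_of d" "fst u = coord d q" by auto
    then show "(case (coord c (point_at d (fst u)), snd u) of (y, w) \<Rightarrow> f (point_at c y) w) =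
        (case u of (y, w) \<Rightarrow> f (point_at d y) w)"
      by (simp add: split_beta pt)
  qed
  then show "\<exists>(a::complex^'b) b. ((\<lambda>(y, w). f (point_at d y) w) has_derivative
      (\<lambda>(h, k). (\<Sum>i\<in>UNIV. a $ i * h $ i) + b * k)) (at (x, z))"
    by blast
qed

lemma analytic_holo:
  assumes c: "is_chart c" and f: "analytic_on_times_plane c f"
  shows "holo c (\<lambda>p. f p z)"
  unfolding holo_def hol_on_def
proof
  fix x assume "x \<in> coord c ` dom_of c"
  then obtain a :: "complex^'b" and b where ab: "((\<lambda>(y, w). f (point_at c y) w) has_derivative
      (\<lambda>(h, k). (\<Sum>i\<in>UNIV. a $ i * h $ i) + b * k)) (at (x, z))"
    using f unfolding analytic_on_times_plane_def by blast
  have "((\<lambda>y. (y, z)) has_derivative (\<lambda>h. (h, 0))) (at x)"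
    by (intro has_derivative_Pair) (auto intro!: derivative_eq_intros)
  from has_derivative_compose[OF this ab]
  show "\<exists>a::complex^'b. ((\<lambda>y. f (point_at c y) z) has_derivative (\<lambda>h. \<Sum>i\<in>UNIV. a $ i * h $ i)) (at x)"
    by (intro exI[of _ a]) simp
qed

text \<open>In \<open>mm\<close> the Jacobian acts only on the direction index, the matrix indices
  staying fixed, so this is not the tensor law: the frame in which solutions are written does not
  change. The Legendre transformation satisfies this by \<open>mult_matrix'\<close>, a restriction
  to a smaller domain with the identity as Jacobian.\<close>

lemma fundamental_solution_transfer:
  assumes cd: "is_chart c" "is_chart d" "compatible c d" "dom_of d \<subseteq> dom_of c"
    and mm: "\<And>p \<alpha> i j. p \<in> dom_of d \<Longrightarrow>
      mult_matrix G d p \<alpha> $ i $ j = (\<Sum>l\<in>UNIV. jac d c p $ l $ \<alpha> * mult_matrix F c p l $ i $ j)"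
    and em: "\<And>p. p \<in> dom_of d \<Longrightarrow> euler_matrix G d p = euler_matrix F c p"
    and fs: "fundamental_solution F c \<eta> \<mu> R T"
  shows "fundamental_solution G d \<eta> \<mu> R T"
proof -
  have an: "analytic_on_times_plane c (\<lambda>p z. T p z $ i $ j)" for i j
    using fs unfolding fundamental_solution_def by blast
  have T: "T p 0 = mat 1" "matrix_inv \<eta> ** transpose (T p (- z)) ** \<eta> ** T p z = mat 1"
    if "p \<in> dom_of d" for p z
    using fs that cd(4) unfolding fundamental_solution_def by blast+
  define Y where "Y L p z = T p z ** zpow (L z) (diag_matrix \<mu>) ** zpow (L z) R" for L :: "complex \<Rightarrow> complex" and p z
  have sol: "det (Y L p z) \<noteq> 0"
    "pd c \<alpha> (\<lambda>q. Y L q z $ i $ j) p = z * (mult_matrix F c p \<alpha> ** Y L p z) $ i $ j"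
    "((\<lambda>w. Y L p w $ i $ j) has_field_derivative
                 ((euler_matrix F c p + mscale (1 / z) (diag_matrix \<mu>)) ** Y L p z) $ i $ j) (at z)"
    if "open W" "L holomorphic_on W" "\<forall>z\<in>W. exp (L z) = z" "p \<in> dom_of d" "z \<in> W" for W L p z i j \<alpha>
  proof -
    have "\<forall>W L. open W \<and> L holomorphic_on W \<and> (\<forall>z\<in>W. exp (L z) = z) \<longrightarrow> (\<forall>p\<in>dom_of c. \<forall>z\<in>W.
              det (Y L p z) \<noteq> 0 \<and>
              (\<forall>i j \<alpha>. pd c \<alpha> (\<lambda>q. Y L q z $ i $ j) p = z * (mult_matrix F c p \<alpha> ** Y L p z) $ i $ j) \<and>
              (\<forall>i j. ((\<lambda>w. Y L p w $ i $ j) has_field_derivative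
                 ((euler_matrix F c p + mscale (1 / z) (diag_matrix \<mu>)) ** Y L p z) $ i $ j) (at z)))"
      using fs unfolding fundamental_solution_def Let_def Y_def by (elim conjE)
    from this[rule_format, of W L p z] that cd(4)
    show "det (Y L p z) \<noteq> 0"
    "pd c \<alpha> (\<lambda>q. Y L q z $ i $ j) p = z * (mult_matrix F c p \<alpha> ** Y L p z) $ i $ j"
    "((\<lambda>w. Y L p w $ i $ j) has_field_derivative
                 ((euler_matrix F c p + mscale (1 / z) (diag_matrix \<mu>)) ** Y L p z) $ i $ j) (at z)"
      by blast+
  qed
  \<comment> \<open>The powers of z do not depend on the point, so each entry is a combination of
    entries of \<open>T\<close> with constant coefficients, and the chain rule applies to
    it.\<close>
  have holo_Y: "holo c (\<lambda>q. Y L q z $ i $ j)" for L z i j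
  proof -
    have "Y L q z $ i $ j = (\<Sum>k\<in>UNIV. (zpow (L z) (diag_matrix \<mu>) ** zpow (L z) R) $ k $ j * T q z $ i $ k)" for q
      by (simp add: Y_def flip: matrix_mul_assoc) (simp add: matrix_matrix_mult_def[of "T q z"] mult.commute)
    then show ?thesis
      by (simp only:) (rule holo_sum_mult[OF analytic_holo[OF cd(1) an]])
  qed
  have pd_Y: "pd d \<alpha> (\<lambda>q. Y L q z $ i $ j) p = z * (mult_matrix G d p \<alpha> ** Y L p z) $ i $ j"
    if "open W" "L holomorphic_on W" "\<forall>z\<in>W. exp (L z) = z" "p \<in> dom_of d" "z \<in> W" for W L p z i j \<alpha>
  proof -
    have "pd d \<alpha> (\<lambda>q. Y L q z $ i $ j) p = (\<Sum>l\<in>UNIV. jac d c p $ l $ \<alpha> * pd c l (\<lambda>q. Y L q z $ i $ j) p)"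
      by (rule holo_transfer(2)[OF cd holo_Y that(4)])
    also have "\<dots> = (\<Sum>l\<in>UNIV. \<Sum>k\<in>UNIV. z * (jac d c p $ l $ \<alpha> * mult_matrix F c p l $ i $ k * Y L p z $ k $ j))"
      unfolding sol(2)[OF that]
      by (simp add: matrix_matrix_mult_def[of "mult_matrix F c p _"] sum_distrib_left mult_ac)
    also have "\<dots> = (\<Sum>k\<in>UNIV. \<Sum>l\<in>UNIV. z * (jac d c p $ l $ \<alpha> * mult_matrix F c p l $ i $ k * Y L p z $ k $ j))"
      by (rule sum.swap)
    also have "\<dots> = z * (mult_matrix G d p \<alpha> ** Y L p z) $ i $ j"
      by (simp add: matrix_matrix_mult_def[of "mult_matrix G d p _"] mm[OF that(4)] sum_distrib_left sum_distrib_right)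
    finally show ?thesis .
  qed
  show ?thesis
    unfolding fundamental_solution_def Let_def Y_def[symmetric]
  proof (intro conjI allI ballI impI)
    show "analytic_on_times_plane d (\<lambda>p z. T p z $ i $ j)" for i j
      by (rule analytic_transfer[OF cd an])
  qed (use T sol pd_Y em in auto)
qed

section \<open>Solutions and calibration of the Legendre transform\<close>

context legendre_chart
begin

lemma compat: "is_chart c" "is_chart c'" "compatible c c'" "dom_of c' \<subseteq> dom_of c"
  using chart chart' compatible by auto

lemma fundamental_solution_legendre:
  assumes "fundamental_solution F c \<eta> \<mu> R T"
  shows "fundamental_solution S c' \<eta> \<mu> R T"
proof (rule fundamental_solution_transfer[OF compat _ _ assms])
  fix p assume "p \<in> dom_of c'"
  then have p: "p \<in> dom_of c" by simp
  show "mult_matrix S c' p \<alpha> $ i $ j = (\<Sum>l\<in>UNIV. K p $ l $ \<alpha> * mult_matrix F c p l $ i $ j)" for \<alpha> i j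
    by (rule mult_matrix'[OF p])
  have "euler_matrix S c' p = euler_matrix F c' p"
    by (simp add: euler_matrix_def legendre_simps)
  then show "euler_matrix S c' p = euler_matrix F c p"
    by (simp add: euler_matrix'[OF p])
qed

abbreviation "\<theta>' \<alpha> m \<equiv> two_point F c \<eta> \<theta> \<alpha> m \<kappa> 0"

lemma pd_theta':
  assumes p: "p \<in> dom_of c"
  shows "pd c' \<gamma> (\<theta>' \<alpha> m) p = pd c \<gamma> (\<theta> \<alpha> m) p"
proof -
  have "dpd c' (\<theta>' \<alpha> m) p = (dpd c (\<theta> \<alpha> m) p v* J p) v* K p"
    using dpd_transfer[OF compat holo_two_point, of p \<alpha> m] p
    by (simp add: dpd_two_point jac_legendre)
  also have "\<dots> = dpd c (\<theta> \<alpha> m) p"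
    by (simp add: vector_matrix_mul_assoc jac_inverses[OF p])
  finally have "dpd c' (\<theta>' \<alpha> m) p $ \<gamma> = dpd c (\<theta> \<alpha> m) p $ \<gamma>" by simp
  then show ?thesis by (simp only: dpd_component)
qed

text \<open>The inner derivative is already an old one by \<open>pd_theta'\<close>, so only the
  outer derivative changes coordinates and no derivative of the Jacobian appears.\<close>

lemma pd_pd_theta':
  assumes p: "p \<in> dom_of c"
  shows "dpd c' (pd c' \<beta> (\<theta>' \<alpha> m)) p = dpd c (pd c \<beta> (\<theta> \<alpha> m)) p v* K p"
proof -
  have "dpd c' (pd c' \<beta> (\<theta>' \<alpha> m)) p = dpd c' (pd c \<beta> (\<theta> \<alpha> m)) p"
    using p by (auto simp: vec_eq_iff dpd_component intro!: pd_cong[OF chart'] pd_theta')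
  also have "\<dots> = dpd c (pd c \<beta> (\<theta> \<alpha> m)) p v* K p"
    using p by (intro dpd_transfer compat holo_pd holo_theta) auto
  finally show ?thesis .
qed

lemma grad_theta':
  assumes p: "p \<in> dom_of c"
  shows "grad S c' (\<theta>' \<alpha> m) p = grad F c (\<theta> \<alpha> m) p"
  by (simp add: grad_def met' pd_theta' flat_components p)

theorem calibration_legendre: "calibration S c' \<kappa> \<eta> \<mu> Rs \<theta>'"
  unfolding calibration_def
proof (intro conjI allI ballI)
  show "holo c' (\<theta>' \<alpha> m)" for \<alpha> m
    by (rule holo_transfer(1)[OF compat holo_two_point])
  fix p assume "p \<in> dom_of c'"
  then have p: "p \<in> dom_of c" by simp
  show "\<theta>' \<alpha> 0 p = (\<Sum>\<rho>\<in>UNIV. \<eta> $ \<alpha> $ \<rho> * coord c' p $ \<rho>)" for \<alpha>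
  proof -
    have "\<phi> p = matrix_inv \<eta> *v (\<chi> \<beta>. \<theta>' \<beta> 0 p)"
      by (simp add: vec_eq_iff legendre_coord_component matrix_vector_mult_def)
    then have "\<eta> *v \<phi> p = (\<chi> \<beta>. \<theta>' \<beta> 0 p)"
      by (simp add: matrix_inv_cancel eta_invertible)
    then have "(\<eta> *v \<phi> p) $ \<alpha> = \<theta>' \<alpha> 0 p" by simp
    then show ?thesis by (simp add: matrix_vector_mult_def)
  qed
  show "pd c' \<alpha> (pd c' \<beta> (\<theta>' \<gamma> (Suc m))) p = (\<Sum>\<sigma>\<in>UNIV. mul S c' p \<sigma> \<alpha> \<beta> * pd c' \<sigma> (\<theta>' \<gamma> m) p)" for \<alpha> \<beta> \<gamma> m
  proof -
    have "pd c' \<alpha> (pd c' \<beta> (\<theta>' \<gamma> (Suc m))) p = (dpd c (pd c \<beta> (\<theta> \<gamma> (Suc m))) p v* K p) $ \<alpha>"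
      by (simp only: pd_pd_theta'[OF p, symmetric] dpd_component)
    also have "\<dots> = (\<Sum>l\<in>UNIV. \<Sum>\<sigma>\<in>UNIV. K p $ l $ \<alpha> * mul F c p \<sigma> l \<beta> * pd c \<sigma> (\<theta> \<gamma> m) p)"
      by (simp add: vector_matrix_mult_def dpd_component calibrationD(2)[OF p] sum_distrib_left mult_ac)
    also have "\<dots> = (\<Sum>\<sigma>\<in>UNIV. \<Sum>l\<in>UNIV. K p $ l $ \<alpha> * mul F c p \<sigma> l \<beta> * pd c \<sigma> (\<theta> \<gamma> m) p)"
      by (rule sum.swap)
    finally show ?thesis
      by (simp add: legendre_simps mul'[OF p] pd_theta'[OF p] sum_distrib_right)
  qed
  show "(\<Sum>\<rho>\<in>UNIV. \<Sum>\<sigma>\<in>UNIV. fps_const (met S c' p $ \<rho> $ \<sigma>) *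
             grad_series S c' (\<theta>' \<alpha>) p \<rho> * fps_compose (grad_series S c' (\<theta>' \<beta>) p \<sigma>) (- fps_X)) =
          fps_const (\<eta> $ \<alpha> $ \<beta>)" for \<alpha> \<beta>
    using calibrationD(3)[OF p, of \<alpha> \<beta>]
    by (simp add: grad_series_def grad_theta'[OF p] met'[OF p] flat_components[OF p])
  \<comment> \<open>The new unity direction is \<kappa>, and the old derivative of
    \<open>\<theta> \<alpha> (Suc m)\<close> in that direction is the two-point function that
    defines \<open>\<theta>' \<alpha> m\<close>.\<close>
  show "pd c' \<kappa> (\<theta>' \<alpha> (Suc m)) p = \<theta>' \<alpha> m p" for \<alpha> m
    by (simp add: pd_theta'[OF p] two_point_eq[OF p])
  show "(\<Sum>\<rho>\<in>UNIV. euler S c' p $ \<rho> * pd c' \<rho> (pd c' \<beta> (\<theta>' \<alpha> m)) p) =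
          (of_nat m + \<mu> \<alpha> + \<mu> \<beta>) * pd c' \<beta> (\<theta>' \<alpha> m) p +
          (\<Sum>\<gamma>\<in>UNIV. \<Sum>k=1..m. Rs k $ \<gamma> $ \<alpha> * pd c' \<beta> (\<theta>' \<gamma> (m - k)) p)" for \<alpha> \<beta> m
  proof -
    let ?v = "dpd c (pd c \<beta> (\<theta> \<alpha> m)) p"
    \<comment> \<open>The factor \<open>J\<close> from the Euler field cancels the factor
      \<open>K\<close> from the outer derivative: differentiation along a vector field does not
      depend on the chart.\<close>
    have "euler S c' p = J p *v euler F c p"
      using tensorial(2)[OF chart_mem', of p] p by (simp add: legendre_simps)
    then have "(\<Sum>\<rho>\<in>UNIV. euler S c' p $ \<rho> * pd c' \<rho> (pd c' \<beta> (\<theta>' \<alpha> m)) p) =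
        (\<Sum>\<rho>\<in>UNIV. (?v v* K p) $ \<rho> * (J p *v euler F c p) $ \<rho>)"
      by (simp add: dpd_component[symmetric] pd_pd_theta'[OF p] mult.commute)
    also have "\<dots> = (\<Sum>\<rho>\<in>UNIV. ((?v v* K p) v* J p) $ \<rho> * euler F c p $ \<rho>)"
      unfolding sum_matrix_vector by (simp add: vector_matrix_mult_def mult.commute)
    also have "\<dots> = (\<Sum>\<rho>\<in>UNIV. euler F c p $ \<rho> * pd c \<rho> (pd c \<beta> (\<theta> \<alpha> m)) p)"
      by (simp add: vector_matrix_mul_assoc jac_inverses[OF p] dpd_component mult.commute)
    finally show ?thesis
      by (simp add: calibrationD(4)[OF p] pd_theta'[OF p])
  qed
qed

lemma calibrates_legendre: "calibrates c \<eta> \<theta> T \<Longrightarrow> calibrates c' \<eta> \<theta>' T"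
  by (simp add: calibrates_def pd_theta')

end

section \<open>Restriction to smaller balls\<close>

text \<open>\<open>point_at\<close> inverts the coordinates on the domain, so shrinking the domain
  changes this function. The two inverses agree on the image of \<open>V\<close>, and openness of
  that image makes the partial derivatives agree.\<close>

lemma restricted_chart:
  assumes c: "is_chart c" and V: "open V" "V \<subseteq> dom_of c"
  shows "is_chart (V, coord c)" "compatible c (V, coord c)"
    and "p \<in> V \<Longrightarrow> pd (V, coord c) i f p = pd c i f p"
proof -
  let ?d = "(V, coord c)"
  have inj: "inj_on (coord c) V"
    using chart_inverse(1)[OF c] V(2) by (intro inj_on_inverseI[of _ "point_at c"]) auto
  have pt: "point_at ?d x = point_at c x" if x: "x \<in> coord c ` V" for x
  proof -
    obtain p where p: "p \<in> V" "x = coord c p" using x by blast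
    have "point_at ?d x = p" using inj p by (simp add: point_at_def)
    then show ?thesis using chart_inverse(1)[OF c, of p] p V by auto
  qed
  have op: "open (coord c ` V)" by (rule open_coord_image[OF c V])
  have conts: "continuous_on (dom_of c) (coord c)" "continuous_on (coord c ` dom_of c) (point_at c)"
    using c by (auto simp: is_chart_def homeomorphism_def)
  have "homeomorphism V (coord c ` V) (coord c) (point_at ?d)"
  proof
    show "continuous_on V (coord c)" using conts(1) V(2) by (rule continuous_on_subset)
    have "continuous_on (coord c ` V) (point_at c)"
      using conts(2) V(2) by (rule continuous_on_subset[OF _ image_mono])
    then show "continuous_on (coord c ` V) (point_at ?d)"
      by (rule continuous_on_eq) (simp add: pt)
  qed (use V chart_inverse(1)[OF c] in \<open>auto simp: pt\<close>)
  then show d: "is_chart ?d"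
    using V op by (simp add: is_chart_def)
  show "pd ?d i f p = pd c i f p" if "p \<in> V"
    unfolding pd_partial using that op by (auto intro!: partial_cong[of "coord c ` V"] simp: pt)
  have sub: "coord c ` V \<subseteq> coord c ` dom_of c" using V by blast
  have hol: "hol_on (\<lambda>x. coord c (point_at c x) $ i) (coord c ` V)" for i
    using holo_coord[OF c, of i] sub unfolding holo_def by (rule hol_on_subset)
  have "hol_on (\<lambda>x. coord c (point_at ?d x) $ i) (coord c ` V)" for i
    by (rule hol_on_cong[OF op _ hol[of i]]) (simp add: pt)
  moreover have "dom_of c \<inter> V = V" using V by blast
  ultimately show "compatible c ?d"
    using hol by (simp add: compatible_def)
qed

text \<open>Components are assigned to each chart separately, so equal coordinate maps do not by
  themselves give equal components; the tensor law with identity Jacobian does.\<close>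

lemma (in flat_chart) restricted_components:
  assumes V: "open V" "V \<subseteq> dom_of c" and p: "p \<in> V"
  defines "d \<equiv> (V, coord c)"
  shows "jac d c p = mat 1" "unity F d p = unity F c p" "euler F d p = euler F c p"
    "mul F d p = mul F c p" "met F d p = met F c p"
proof -
  note d = restricted_chart[OF chart V, folded d_def]
  have mem: "d \<in> charts F" using V by (intro chart_memI d) (simp add: d_def)
  have pc: "p \<in> dom_of c" "p \<in> dom_of d" using p V by (auto simp: d_def)
  have "pd d i (\<lambda>q. coord c q $ a) p = (if a = i then 1 else 0)" for i a
    using pd_coord[OF d(1) pc(2), of i a] by (simp add: d_def)
  then show "jac d c p = mat 1"
    by (simp add: jac_def vec_eq_iff mat_def)
  have j: "jac c d p = mat 1"
    using pd_coord[OF chart pc(1)] by (simp add: jac_def vec_eq_iff mat_def d_def)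
  note t = tensorial[OF mem pc, unfolded j matrix_vector_mul_lid]
  show "unity F d p = unity F c p" "euler F d p = euler F c p"
    by (rule t)+
  show "mul F d p = mul F c p"
    by (intro ext) (simp only: vmul_axis_axis[symmetric] t(3))
  have "met F d p $ i $ j = met F c p $ i $ j" for i j
    using t(4)[of "axis i 1" "axis j 1"] by (simp add: ip_axis matrix_vector_axis)
  then show "met F d p = met F c p" by (simp add: vec_eq_iff)
qed

lemma (in flat_chart) flat_chart_restrict:
  assumes V: "open V" "V \<subseteq> dom_of c" "V \<noteq> {}"
  shows "flat_chart F D (V, coord c) \<iota> \<eta> \<mu> r"
proof
  note d = restricted_chart[OF chart V(1,2)]
  have "(V, coord c) \<in> charts F" using V by (intro chart_memI d) simp
  moreover have "\<mu> \<iota> = - D / 2" "r \<iota> = 0" using flat by (auto simp: flat_coordinates_def)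
  ultimately show "flat_coordinates F D (V, coord c) \<iota> \<eta> \<mu> r"
    using V by (simp add: flat_coordinates_def restricted_components subsetD flat_components)
qed (use frob V in auto)

lemma (in flat_chart) fundamental_solution_restrict:
  assumes V: "open V" "V \<subseteq> dom_of c" and T: "fundamental_solution F c \<eta> \<mu> R T"
  shows "fundamental_solution F (V, coord c) \<eta> \<mu> R T"
proof (rule fundamental_solution_transfer[OF chart restricted_chart(1,2)[OF chart V] _ _ _ T])
  fix p assume "p \<in> dom_of (V, coord c)"
  then have p: "p \<in> V" by simp
  note rc = restricted_components[OF V p]
  show "mult_matrix F (V, coord c) p \<alpha> $ i $ j =
      (\<Sum>l\<in>UNIV. jac (V, coord c) c p $ l $ \<alpha> * mult_matrix F c p l $ i $ j)" for \<alpha> i j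
  proof -
    have "(\<Sum>l\<in>UNIV. jac (V, coord c) c p $ l $ \<alpha> * mult_matrix F c p l $ i $ j) =
        (\<Sum>l\<in>UNIV. (if \<alpha> = l then 1 else 0) * mult_matrix F c p l $ i $ j)"
      by (intro sum.cong refl) (auto simp: rc(1) mat_def)
    then show ?thesis by (simp only: delta_sum) (simp add: mult_matrix_def rc)
  qed
  show "euler_matrix F (V, coord c) p = euler_matrix F c p"
    by (simp add: euler_matrix_def rc)
qed (use V in simp)

lemma (in calibrated_chart) calibrated_chart_restrict:
  assumes V: "open V" "V \<subseteq> dom_of c" "V \<noteq> {}"
  shows "calibrated_chart F D (V, coord c) \<iota> \<eta> \<mu> r R Rs \<theta> \<kappa>"
proof -
  let ?d = "(V, coord c)"
  note rc = restricted_components[OF V(1,2)]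
  note d = restricted_chart[OF chart V(1,2)]
  interpret d: flat_chart F D ?d \<iota> \<eta> \<mu> r by (rule flat_chart_restrict[OF V])
  \<comment> \<open>For second derivatives, \<open>d(3)\<close> rewrites only the outer one. The
    inner one stands as a function that agrees with the old one just on \<open>V\<close>, so it is
    exchanged by a congruence in the restricted chart.\<close>
  have pd2: "pd c i (pd ?d j f) p = pd c i (pd c j f) p" if "p \<in> V" for i j f p
    using pd_cong[OF d(1), of "pd ?d j f" "pd c j f" p i] that by (simp add: d(3))
  have gr: "grad F ?d f p = grad F c f p" if "p \<in> V" for f p
    by (simp add: grad_def rc d(3) that)
  have "unit": "\<forall>p\<in>dom_of ?d. invertible (mult_matrix F ?d p \<kappa>)"
  proof
    fix p assume "p \<in> dom_of ?d"
    then have p: "p \<in> V" "p \<in> dom_of c" using V by auto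
    have "mult_matrix F ?d p \<kappa> = mult_matrix F c p \<kappa>" by (simp add: mult_matrix_def rc p)
    then show "invertible (mult_matrix F ?d p \<kappa>)" using unit p by simp
  qed
  have "calibration F ?d \<iota> \<eta> \<mu> Rs \<theta>"
    unfolding calibration_def
  proof (intro conjI ballI)
    show "\<forall>\<alpha> m. holo ?d (\<theta> \<alpha> m)"
      using V by (intro allI holo_transfer(1)[OF chart d(1,2) _ holo_theta]) simp
  qed (use cal V in \<open>auto simp: calibration_def pd2 rc d(3) gr grad_series_def subset_eq\<close>)
  then show ?thesis
    using exponents "unit" by unfold_locales
qed

text \<open>Each two-point function involved is a single derivative by \<open>two_point_eq\<close>,
  in either chart, so the definite descriptions need not be compared.\<close>

lemma (in calibrated_chart) legendre_coord_restrict: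
  assumes V: "open V" "V \<subseteq> dom_of c" and p: "p \<in> V"
  shows "legendre_coord F (V, coord c) \<eta> \<theta> \<kappa> p = legendre_coord F c \<eta> \<theta> \<kappa> p"
proof -
  interpret d: calibrated_chart F D "(V, coord c)" \<iota> \<eta> \<mu> r R Rs \<theta> \<kappa>
    using p by (intro calibrated_chart_restrict V) auto
  have "two_point F (V, coord c) \<eta> \<theta> \<alpha> m \<kappa> 0 p = two_point F c \<eta> \<theta> \<alpha> m \<kappa> 0 p" for \<alpha> m
    using p V two_point_eq[of p] d.two_point_eq[of p] restricted_chart(3)[OF chart V p] by auto
  then show ?thesis by (simp add: legendre_coord_def)
qed

section \<open>Local injectivity of the new coordinates\<close>

lemma norm_le_sum_components: "norm (x :: complex^'n) \<le> (\<Sum>i\<in>UNIV. norm (x $ i))"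
  unfolding norm_vec_def by (rule L2_set_le_sum) simp

text \<open>A crude bound that converts entrywise continuity of a matrix function into continuity in
  operator norm.\<close>

lemma onorm_matrix_le: "onorm ((*v) (A :: complex^'n^'m)) \<le> (\<Sum>i\<in>UNIV. \<Sum>j\<in>UNIV. norm (A $ i $ j))"
proof (rule onorm_bound)
  fix x :: "complex^'n"
  have "norm (A *v x) \<le> (\<Sum>i\<in>UNIV. norm ((A *v x) $ i))" by (rule norm_le_sum_components)
  also have "\<dots> \<le> (\<Sum>i\<in>UNIV. \<Sum>j\<in>UNIV. norm (A $ i $ j) * norm x)"
  proof (rule sum_mono)
    fix i
    have "norm ((A *v x) $ i) \<le> (\<Sum>j\<in>UNIV. norm (A $ i $ j * x $ j))"
      unfolding matrix_vector_mult_def by (simp add: norm_sum)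
    also have "\<dots> \<le> (\<Sum>j\<in>UNIV. norm (A $ i $ j) * norm x)"
      by (intro sum_mono) (simp add: norm_mult mult_left_mono Finite_Cartesian_Product.norm_nth_le)
    finally show "norm ((A *v x) $ i) \<le> (\<Sum>j\<in>UNIV. norm (A $ i $ j) * norm x)" .
  qed
  finally show "norm (A *v x) \<le> (\<Sum>i\<in>UNIV. \<Sum>j\<in>UNIV. norm (A $ i $ j)) * norm x"
    by (simp add: sum_distrib_right)
qed (intro sum_nonneg norm_ge_zero)

text \<open>The derivative at \<open>a\<close> is the invertible multiplication matrix, and it
  varies continuously because the structure functions are holomorphic. This is what local
  injectivity of a differentiable map requires.\<close>

lemma (in calibrated_chart) locally_injective:
  assumes a: "a \<in> coord c ` dom_of c"
  obtains e where "e > 0" "inj_on \<phi> {p \<in> dom_of c. coord c p \<in> ball a e}"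
proof -
  let ?U = "coord c ` dom_of c"
  define M where "M x = mult_matrix F c (point_at c x) \<kappa>" for x
  have U: "open ?U" using chart by (simp add: is_chart_def)
  have der: "((\<lambda>x. \<phi> (point_at c x)) has_derivative (*v) (M x)) (at x)" if x: "x \<in> ?U" for x
  proof -
    have p: "point_at c x \<in> dom_of c" "coord c (point_at c x) = x"
      using x by (auto simp: chart_inverse[OF chart])
    show ?thesis
      using holo_has_derivative[OF chart holo_legendre_coord p(1)]
      by (intro has_derivative_vec) (simp add: pd_legendre_coord[OF p(1)] p(2) M_def matrix_vector_mult_def)
  qed
  have inv: "invertible (M a)"
    using a unit by (auto simp: M_def chart_inverse[OF chart])
  have near: "\<exists>d>0. \<forall>x. dist a x < d \<longrightarrow> onorm (\<lambda>v. M x *v v - M a *v v) < e" if "e > 0" for e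
  proof -
    \<comment> \<open>The sum of entrywise distances is continuous, vanishes at \<open>a\<close> and
      bounds the operator norm of the difference.\<close>
    define s where "s x = (\<Sum>i\<in>UNIV. \<Sum>j\<in>UNIV. norm (M x $ i $ j - M a $ i $ j))" for x
    have "continuous_on ?U (\<lambda>x. M x $ i $ j)" for i j
      by (simp add: M_def mult_matrix_def) (rule hol_on_continuous_on[OF holo_mul[unfolded holo_def]])
    then have cont: "isCont (\<lambda>x. M x $ i $ j) a" for i j
      using continuous_on_eq_continuous_at[OF U] a by blast
    then have "isCont s a"
      unfolding s_def by (intro continuous_sum continuous_norm continuous_diff continuous_const cont)
    then have "\<forall>e>0. \<exists>d>0. \<forall>x. dist x a < d \<longrightarrow> dist (s x) (s a) < e"
      by (simp add: continuous_at_eps_delta)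
    then obtain d where d: "d > 0" "\<And>x. dist x a < d \<Longrightarrow> dist (s x) (s a) < e"
      using \<open>e > 0\<close> by blast
    have "onorm (\<lambda>v. M x *v v - M a *v v) < e" if "dist a x < d" for x
    proof -
      have "onorm (\<lambda>v. M x *v v - M a *v v) = onorm ((*v) (M x - M a))"
        by (simp flip: matrix_vector_mult_diff_rdistrib)
      also have "\<dots> \<le> s x" using onorm_matrix_le[of "M x - M a"] by (simp add: s_def)
      also have "\<dots> < e" using d(2)[of x] that by (simp add: s_def dist_commute dist_real_def)
      finally show ?thesis .
    qed
    with d(1) show ?thesis by blast
  qed
  obtain e where e: "e > 0" "ball a e \<subseteq> ?U" "inj_on (\<lambda>x. \<phi> (point_at c x)) (ball a e)"
  proof (rule has_derivative_locally_injective[OF a U bounded_linear_matrix_vector[of "matrix_inv (M a)"] _ der near])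
    show "(*v) (matrix_inv (M a)) \<circ> (*v) (M a) = id"
      by (simp add: fun_eq_iff matrix_inv_cancel inv)
  qed blast+
  show thesis
  proof (rule that[OF e(1)])
    show "inj_on \<phi> {p \<in> dom_of c. coord c p \<in> ball a e}"
    proof (rule inj_onI)
      fix p q assume p: "p \<in> {p \<in> dom_of c. coord c p \<in> ball a e}"
        and q: "q \<in> {p \<in> dom_of c. coord c p \<in> ball a e}" and eq: "\<phi> p = \<phi> q"
      have pt: "point_at c (coord c p) = p" "point_at c (coord c q) = q"
        using p q by (auto intro: chart_inverse(1)[OF chart])
      have "coord c p = coord c q"
        by (rule inj_onD[OF e(3)]) (use p q eq in \<open>simp_all add: pt\<close>)
      then show "p = q" using pt by metis
    qed
  qed
qed

text \<open>A sufficiently small ball is made explicit in two parts: all small radii give injective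
  new coordinates, and every radius up to \<rho> with that property gives the conclusions. The
  clause about \<open>T\<close> adds that a fundamental solution whose columns are the gradients of
  the old calibration has a counterpart for the new one.\<close>

theorem theorem1:
  fixes F :: "('m::{t2_space, second_countable_topology}, 'n::finite) frobenius"
    and D :: complex and c :: "('m, 'n) chart" and \<iota> \<kappa> :: 'n
    and \<eta> R :: "complex^'n^'n" and \<mu> r :: "'n \<Rightarrow> complex"
    and Rs :: "nat \<Rightarrow> complex^'n^'n"
    and \<theta> :: "'n \<Rightarrow> nat \<Rightarrow> 'm \<Rightarrow> complex"
    and a :: "complex^'n" and \<rho> :: real
  assumes "frobenius_manifold F D"
    and "flat_coordinates F D c \<iota> \<eta> \<mu> r"
    and "\<rho> > 0" and "coord c ` dom_of c = ball a \<rho>"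
    and "monodromy_data F c \<eta> \<mu> R Rs"
    and "calibration F c \<iota> \<eta> \<mu> Rs \<theta>"
    and "\<forall>p\<in>dom_of c. invertible (mult_matrix F c p \<kappa>)"
  shows
    "(\<exists>\<epsilon>>0. \<forall>\<delta>. 0 < \<delta> \<and> \<delta> \<le> \<epsilon> \<longrightarrow>
        inj_on (legendre_coord F (shrink c a \<delta>) \<eta> \<theta> \<kappa>) (dom_of (shrink c a \<delta>))) \<and>
     (\<forall>\<delta>. 0 < \<delta> \<and> \<delta> \<le> \<rho> \<and>
        inj_on (legendre_coord F (shrink c a \<delta>) \<eta> \<theta> \<kappa>) (dom_of (shrink c a \<delta>)) \<longrightarrow>
      (let B = shrink c a \<delta>;
           S = legendre F B \<kappa>;
           c' = (dom_of B, legendre_coord F B \<eta> \<theta> \<kappa>);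
           \<theta>' = (\<lambda>\<alpha> m. two_point F B \<eta> \<theta> \<alpha> m \<kappa> 0)
       in flat_coordinates S (- 2 * \<mu> \<kappa>) c' \<kappa> \<eta> \<mu> (\<lambda>\<beta>. Rs 1 $ \<beta> $ \<kappa>) \<and>
          monodromy_data S c' \<eta> \<mu> R Rs \<and>
          calibration S c' \<kappa> \<eta> \<mu> Rs \<theta>' \<and>
          (\<forall>T. fundamental_solution F B \<eta> \<mu> R T \<and> calibrates B \<eta> \<theta> T \<longrightarrow>
             (\<exists>T'. fundamental_solution S c' \<eta> \<mu> R T' \<and> calibrates c' \<eta> \<theta>' T'))))"
proof -
  have exps: "monodromy_exponents \<eta> \<mu> R Rs" using assms(5) by (simp add: monodromy_data_def)
  \<comment> \<open>One solution on the full chart serves every radius, since it restricts to each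
    smaller ball.\<close>
  obtain T0 where T0: "fundamental_solution F c \<eta> \<mu> R T0"
    using assms(5) unfolding monodromy_data_def by (elim conjE exE)
  have "dom_of c \<noteq> {}" using assms(3,4) by (metis centre_in_ball empty_iff image_empty)
  then interpret calibrated_chart F D c \<iota> \<eta> \<mu> r R Rs \<theta> \<kappa>
    using assms(1,2,6,7) exps
    by (intro calibrated_chart.intro calibrated_chart_axioms.intro flat_chart.intro)
  define V where "V \<delta> = {p \<in> dom_of c. coord c p \<in> ball a \<delta>}" for \<delta>
  have shrink: "shrink c a \<delta> = (V \<delta>, coord c)" for \<delta>
    by (simp add: shrink_def V_def)
  have V: "open (V \<delta>)" "V \<delta> \<subseteq> dom_of c" for \<delta>
  proof -
    have "open (dom_of c \<inter> coord c -` ball a \<delta>)"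
      using chart by (intro continuous_open_preimage) (auto simp: is_chart_def homeomorphism_def)
    moreover have "V \<delta> = dom_of c \<inter> coord c -` ball a \<delta>" by (auto simp: V_def)
    ultimately show "open (V \<delta>)" by simp
  qed (auto simp: V_def)
  have V_nonempty: "V \<delta> \<noteq> {}" if "\<delta> > 0" for \<delta>
  proof -
    have "a \<in> coord c ` dom_of c" using assms(3,4) by simp
    then obtain p where "p \<in> dom_of c" "coord c p = a" by blast
    then show ?thesis using that by (auto simp: V_def)
  qed
  have "a \<in> coord c ` dom_of c" using assms(3,4) by simp
  then obtain e where e: "e > 0" "inj_on \<phi> (V e)"
    by (rule locally_injective[of a, folded V_def])
  show ?thesis
  proof (intro conjI allI impI)
    show "\<exists>\<epsilon>>0. \<forall>\<delta>. 0 < \<delta> \<and> \<delta> \<le> \<epsilon> \<longrightarrow>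
        inj_on (legendre_coord F (shrink c a \<delta>) \<eta> \<theta> \<kappa>) (dom_of (shrink c a \<delta>))"
    proof (intro exI[of _ e] conjI allI impI e(1))
      fix \<delta> assume "0 < \<delta> \<and> \<delta> \<le> e"
      then have "V \<delta> \<subseteq> V e" by (auto simp: V_def)
      with e(2) have inj: "inj_on \<phi> (V \<delta>)" by (rule inj_on_subset)
      show "inj_on (legendre_coord F (shrink c a \<delta>) \<eta> \<theta> \<kappa>) (dom_of (shrink c a \<delta>))"
        unfolding shrink fst_conv
      proof (rule inj_onI)
        fix p q assume p: "p \<in> V \<delta>" and q: "q \<in> V \<delta>"
          and "legendre_coord F (V \<delta>, coord c) \<eta> \<theta> \<kappa> p = legendre_coord F (V \<delta>, coord c) \<eta> \<theta> \<kappa> q"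
        \<comment> \<open>The coordinates in the statement are formed in the shrunken chart, whereas
          the radius \<open>e\<close> was found for those of \<open>c\<close>; they agree on the
          smaller ball.\<close>
        then have "\<phi> p = \<phi> q"
          by (simp only: legendre_coord_restrict[OF V p] legendre_coord_restrict[OF V q])
        then show "p = q" using p q by (rule inj_onD[OF inj])
      qed
    qed
  next
    fix \<delta> assume \<delta>: "0 < \<delta> \<and> \<delta> \<le> \<rho> \<and>
        inj_on (legendre_coord F (shrink c a \<delta>) \<eta> \<theta> \<kappa>) (dom_of (shrink c a \<delta>))"
    let ?B = "(V \<delta>, coord c)"
    interpret B: calibrated_chart F D ?B \<iota> \<eta> \<mu> r R Rs \<theta> \<kappa>
      using \<delta> by (intro calibrated_chart_restrict V V_nonempty) auto
    \<comment> \<open>The injectivity assumed for \<delta> already concerns the coordinates formed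
      in the shrunken chart, so it is the locale assumption as it stands.\<close>
    interpret B: legendre_chart F D ?B \<iota> \<eta> \<mu> r R Rs \<theta> \<kappa>
      using \<delta> by unfold_locales (simp add: shrink)
    have "monodromy_data B.S B.c' \<eta> \<mu> R Rs"
      unfolding monodromy_data_def
      by (intro conjI exI[of _ T0] exps B.fundamental_solution_legendre fundamental_solution_restrict V T0)
    then show "let B = shrink c a \<delta>;
           S = legendre F B \<kappa>;
           c' = (dom_of B, legendre_coord F B \<eta> \<theta> \<kappa>);
           \<theta>' = (\<lambda>\<alpha> m. two_point F B \<eta> \<theta> \<alpha> m \<kappa> 0)
       in flat_coordinates S (- 2 * \<mu> \<kappa>) c' \<kappa> \<eta> \<mu> (\<lambda>\<beta>. Rs 1 $ \<beta> $ \<kappa>) \<and>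
          monodromy_data S c' \<eta> \<mu> R Rs \<and>
          calibration S c' \<kappa> \<eta> \<mu> Rs \<theta>' \<and>
          (\<forall>T. fundamental_solution F B \<eta> \<mu> R T \<and> calibrates B \<eta> \<theta> T \<longrightarrow>
             (\<exists>T'. fundamental_solution S c' \<eta> \<mu> R T' \<and> calibrates c' \<eta> \<theta>' T'))"
      unfolding Let_def shrink
    proof (intro conjI allI impI B.flat_coordinates_legendre B.calibration_legendre)
      fix T assume "fundamental_solution F ?B \<eta> \<mu> R T \<and> calibrates ?B \<eta> \<theta> T"
      then show "\<exists>T'. fundamental_solution B.S B.c' \<eta> \<mu> R T' \<and> calibrates B.c' \<eta> B.\<theta>' T'"
        by (intro exI[of _ T] conjI B.fundamental_solution_legendre B.calibrates_legendre) auto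
    qed
  qed
qed

end
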